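(* In the setting of the context, let $\mathbf{C}\in T$ be the unique element satisfying $\mathbf{A}+\frac{q\mathbf{B}\mathbf{C}-q^{-1}\mathbf{C}\mathbf{B}}{q^2-q^{-2}}=\frac{(\mathbf{a}+\mathbf{a}^{-1})(\Lambda+\Lambda^{-1})+(\mathbf{b}+\mathbf{b}^{-1})(\mathbf{c}+\mathbf{c}^{-1})}{q+q^{-1}}$, $\mathbf{B}+\frac{q\mathbf{C}\mathbf{A}-q^{-1}\mathbf{A}\mathbf{C}}{q^2-q^{-2}}=\frac{(\mathbf{b}+\mathbf{b}^{-1})(\Lambda+\Lambda^{-1})+(\mathbf{c}+\mathbf{c}^{-1})(\mathbf{a}+\mathbf{a}^{-1})}{q+q^{-1}}$ and $\mathbf{C}+\frac{q\mathbf{A}\mathbf{B}-q^{-1}\mathbf{B}\mathbf{A}}{q^2-q^{-2}}=\frac{(\mathbf{c}+\mathbf{c}^{-1})(\Lambda+\Lambda^{-1})+(\mathbf{a}+\mathbf{a}^{-1})(\mathbf{b}+\mathbf{b}^{-1})}{q+q^{-1}}$. Then $$\mathbf{A}+\frac{q\mathbf{B}\mathbf{C}-q^{-1}\mathbf{C}\mathbf{B}}{q^2-q^{-2}}=0,\quad \mathbf{B}+\frac{q\mathbf{C}\mathbf{A}-q^{-1}\mathbf{A}\mathbf{C}}{q^2-q^{-2}}=0,\quad \mathbf{C}+\frac{q\mathbf{A}\mathbf{B}-q^{-1}\mathbf{B}\mathbf{A}}{q^2-q^{-2}}=0.$$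
   Context: Let $\Gamma$ be a finite connected undirected distance-regular graph (no loops or multiple edges) with vertex set $X$, distance $\partial$ and diameter $D\ge3$, which is bipartite and 2-homogeneous in the sense of Nomura (for all $1\le i\le D$, all $y,z$ with $\partial(y,z)=2$ and all $t$ with $\partial(y,t)=\partial(z,t)=i$, $|\Gamma_1(y)\cap\Gamma_1(z)\cap\Gamma_{i-1}(t)|$ depends only on $i$), and not a hypercube; $V=\mathbb{C}^X$. Let $A$ be the adjacency matrix, $E_0=|X|^{-1}J$ and $E_1,\dots,E_D$ a $Q$-polynomial ordering of the nontrivial primitive idempotents of the Bose–Mesner algebra, $A=\sum_i\theta_iE_i$. Fix a vertex $x$; $E_i^*$ is the diagonal $0/1$ matrix projecting onto vertices at distance $i$ from $x$; $A^*$ is diagonal with $(y,y)$-entry $|X|(E_1)_{xy}$, $A^*=\sum\theta_i^*E_i^*$; $T$ is the algebra generated by $A,A^*$. It is known that there is a nonzero $q\in\mathbb{C}$ with $q^4\ne1$ such that $\theta_i=\theta_i^*=\frac{q^{D-2}+q^{2-D}}{q^2-q^{-2}}(q^{D-2i}-q^{2i-D})$; fix such $q$. Set $w=w^*=0$, $v=v^*=-u=-u^*=\frac{q^{D-2}+q^{2-D}}{q^2-q^{-2}}$; fix $a,b$ with $a^2=u/v$, $b^2=u^*/v^*$; $\mathbf{A}=(A-wI)/(av)$, $\mathbf{B}=(A^*-w^*I)/(bv^* )$. For an irreducible $T$-module $W\subseteq V$: endpoint $\rho=\min\{i:E^*_iW\ne0\}$, dual endpoint $\tau=\min\{i:E_iW\ne0\}$,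 diameter $d=|\{i:E_i^*W\ne0\}|-1$. It is known that every irreducible $T$-module is thin ($\dim E_i^*W\le1$), with $\tau=\rho$ and $d=D-2\rho$. Put $a(W)=aq^{2\tau+d-D}$, $b(W)=bq^{2\rho+d-D}$. Then $(\mathbf{A}|_W,\{E_{\tau+i}|_W\}_{i=0}^d,\mathbf{B}|_W,\{E^*_{\rho+i}|_W\}_{i=0}^d)$ is a Leonard system with eigenvalues $\vartheta_i=a(W)q^{2i-d}+a(W)^{-1}q^{d-2i}$ and dual eigenvalues $\vartheta^*_i=b(W)q^{2i-d}+b(W)^{-1}q^{d-2i}$. Let $\kappa=0$ if $d=0$ and, for $d\ge1$, $\kappa=a(W)b(W)^{-1}q^{d-1}+a(W)^{-1}b(W)q^{1-d}+\phi_1/((q-q^{-1})(q^d-q^{-d}))$ with $\phi_1=(\vartheta^*_0-\vartheta^*_1)(\mathrm{trace}(E^*_\rho\mathbf{A}|_W)-\vartheta_d)$; $c(W)$ is a root of $\xi^2-\kappa\xi+1=0$. Isomorphism of irreducible modules: linear bijection commuting with $T$; $\Psi$ = set of types; for $\psi\in\Psi$, $a(\psi),b(\psi),d(\psi),c(\psi)$ are $a(W),b(W)$, the diameter, and (a fixed choice of) $c(W)$ for $W$ of type $\psi$. $V_\psi$ = span of irreducible modules of type $\psi$, $V=\bigoplus_\psi V_\psi$, $e_\psi$ = identity on $V_\psi$ and $0$ on other $V_\lambda$. Define $\mathbf{a}=\sum_\psi a(\psi)e_\psi$, $\mathbf{b}=\sum_\psi b(\psi)e_\psi$, $\mathbf{c}=\sum_\psi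 c(\psi)e_\psi$, $\Lambda=\sum_\psi q^{d(\psi)+1}e_\psi$ (invertible, with inverses $\sum_\psi a(\psi)^{-1}e_\psi$, etc.). *)

theory Defs
  imports "HOL-Analysis.Analysis"
begin

type_synonym 'v cvec = "complex^'v"
type_synonym 'v cmat = "complex^'v^'v"

definition smat :: "complex \<Rightarrow> 'v::finite cmat \<Rightarrow> 'v::finite cmat" where
  "smat c M = (\<chi> i j. c * M$i$j)"

definition Jmat :: "'v::finite cmat" where
  "Jmat = (\<chi> i j. 1)"

definition hadamard :: "'v::finite cmat \<Rightarrow> 'v::finite cmat \<Rightarrow> 'v::finite cmat" where
  "hadamard M N = (\<chi> i j. M$i$j * N$i$j)"

definition adjrel :: "('v \<Rightarrow> 'v \<Rightarrow> bool) \<Rightarrow> ('v \<times> 'v) set" where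
  "adjrel adj = {(u, w). adj u w}"

definition simple_graph :: "('v \<Rightarrow> 'v \<Rightarrow> bool) \<Rightarrow> bool" where
  "simple_graph adj \<longleftrightarrow> (\<forall>u w. adj u w \<longrightarrow> adj w u) \<and> (\<forall>u. \<not> adj u u)"

definition connected_graph :: "('v \<Rightarrow> 'v \<Rightarrow> bool) \<Rightarrow> bool" where
  "connected_graph adj \<longleftrightarrow> (\<forall>u w. \<exists>n. (u, w) \<in> adjrel adj ^^ n)"

definition gdist :: "('v \<Rightarrow> 'v \<Rightarrow> bool) \<Rightarrow> 'v \<Rightarrow> 'v \<Rightarrow> nat" where
  "gdist adj u w = (LEAST n. (u, w) \<in> adjrel adj ^^ n)"

definition diam :: "('v::finite \<Rightarrow> 'v \<Rightarrow> bool) \<Rightarrow> nat" where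
  "diam adj = Max {gdist adj u w | u w. True}"

definition distance_regular :: "('v \<Rightarrow> 'v \<Rightarrow> bool) \<Rightarrow> bool" where
  "distance_regular adj \<longleftrightarrow> (\<exists>p :: nat \<Rightarrow> nat \<Rightarrow> nat \<Rightarrow> nat. \<forall>u w i j.
     card {z. gdist adj u z = i \<and> gdist adj w z = j} = p i j (gdist adj u w))"

definition bipartite :: "('v \<Rightarrow> 'v \<Rightarrow> bool) \<Rightarrow> bool" where
  "bipartite adj \<longleftrightarrow> (\<exists>S. \<forall>u w. adj u w \<longrightarrow> (u \<in> S \<longleftrightarrow> w \<notin> S))"

text \<open>2-homogeneous in the sense of Nomura\<close>
definition two_homogeneous :: "('v::finite \<Rightarrow> 'v \<Rightarrow> bool) \<Rightarrow> bool" where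
  "two_homogeneous adj \<longleftrightarrow> (\<forall>i. 1 \<le> i \<and> i \<le> diam adj \<longrightarrow> (\<exists>\<gamma>. \<forall>y z t.
     gdist adj y z = 2 \<and> gdist adj y t = i \<and> gdist adj z t = i \<longrightarrow>
     card {w. gdist adj y w = 1 \<and> gdist adj z w = 1 \<and> gdist adj t w = i - 1} = \<gamma>))"

definition is_hypercube :: "('v \<Rightarrow> 'v \<Rightarrow> bool) \<Rightarrow> bool" where
  "is_hypercube adj \<longleftrightarrow> (\<exists>(n::nat) (f :: 'v \<Rightarrow> nat set). bij_betw f UNIV (Pow {..<n}) \<and>
     (\<forall>u w. adj u w \<longleftrightarrow> card ((f u - f w) \<union> (f w - f u)) = 1))"

definition Amat :: "('v \<Rightarrow> 'v \<Rightarrow> bool) \<Rightarrow> 'v::finite cmat" where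
  "Amat adj = (\<chi> y z. if adj y z then 1 else 0)"

definition distmat :: "('v \<Rightarrow> 'v \<Rightarrow> bool) \<Rightarrow> nat \<Rightarrow> 'v::finite cmat" where
  "distmat adj i = (\<chi> y z. if gdist adj y z = i then 1 else 0)"

definition BM :: "('v::finite \<Rightarrow> 'v \<Rightarrow> bool) \<Rightarrow> 'v::finite cmat set" where
  "BM adj = {M. \<exists>c. M = (\<Sum>i\<le>diam adj. smat (c i) (distmat adj i))}"

definition prim_idem :: "'v::finite cmat set \<Rightarrow> 'v::finite cmat \<Rightarrow> bool" where
  "prim_idem M P \<longleftrightarrow> P \<in> M \<and> P ** P = P \<and> P \<noteq> 0 \<and>
     \<not> (\<exists>F\<in>M. \<exists>G\<in>M. F ** F = F \<and> G ** G = G \<and> F \<noteq> 0 \<and> G \<noteq> 0 \<and> F ** G = 0 \<and> P = F + G)"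

definition Q_polynomial :: "('v::finite \<Rightarrow> 'v \<Rightarrow> bool) \<Rightarrow> (nat \<Rightarrow> 'v::finite cmat) \<Rightarrow> bool" where
  "Q_polynomial adj E \<longleftrightarrow> (\<exists>qk :: nat \<Rightarrow> nat \<Rightarrow> nat \<Rightarrow> complex.
     (\<forall>i\<le>diam adj. \<forall>j\<le>diam adj. hadamard (E i) (E j) =
         smat (1 / of_nat CARD('v)) (\<Sum>h\<le>diam adj. smat (qk i j h) (E h))) \<and>
     (\<forall>h i j. h \<le> diam adj \<and> i \<le> diam adj \<and> j \<le> diam adj \<longrightarrow>
        ((h > i + j \<or> i > h + j \<or> j > h + i) \<longrightarrow> qk i j h = 0) \<and>
        ((h = i + j \<or> i = h + j \<or> j = h + i) \<longrightarrow> qk i j h \<noteq> 0)))"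

definition Astar :: "(nat \<Rightarrow> 'v::finite cmat) \<Rightarrow> 'v \<Rightarrow> 'v::finite cmat" where
  "Astar E x = (\<chi> y z. if y = z then of_nat CARD('v) * E 1 $ x $ y else 0)"

definition Estar :: "('v \<Rightarrow> 'v \<Rightarrow> bool) \<Rightarrow> 'v \<Rightarrow> nat \<Rightarrow> 'v::finite cmat" where
  "Estar adj x i = (\<chi> y z. if y = z \<and> gdist adj x y = i then 1 else 0)"

definition vpar :: "complex \<Rightarrow> nat \<Rightarrow> complex" where
  "vpar q D = (q powi (int D - 2) + q powi (2 - int D)) / (q\<^sup>2 - q powi (-2))"

definition thq :: "complex \<Rightarrow> nat \<Rightarrow> nat \<Rightarrow> complex" where
  "thq q D i = vpar q D * (q powi (int D - 2 * int i) - q powi (2 * int i - int D))"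

inductive_set Talg :: "'v::finite cmat \<Rightarrow> 'v::finite cmat \<Rightarrow> 'v::finite cmat set" for A As where
  one: "mat 1 \<in> Talg A As"
| gA: "A \<in> Talg A As"
| gAs: "As \<in> Talg A As"
| add: "M \<in> Talg A As \<Longrightarrow> N \<in> Talg A As \<Longrightarrow> M + N \<in> Talg A As"
| scale: "M \<in> Talg A As \<Longrightarrow> smat c M \<in> Talg A As"
| mult: "M \<in> Talg A As \<Longrightarrow> N \<in> Talg A As \<Longrightarrow> M ** N \<in> Talg A As"

definition csubspace :: "'v::finite cvec set \<Rightarrow> bool" where
  "csubspace W \<longleftrightarrow> 0 \<in> W \<and> (\<forall>u\<in>W. \<forall>w\<in>W. u + w \<in> W) \<and> (\<forall>c. \<forall>u\<in>W. c *s u \<in> W)"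

definition Tmodule :: "'v::finite cmat set \<Rightarrow> 'v::finite cvec set \<Rightarrow> bool" where
  "Tmodule T W \<longleftrightarrow> csubspace W \<and> (\<forall>M\<in>T. \<forall>w\<in>W. M *v w \<in> W)"

definition irreducible_mod :: "'v::finite cmat set \<Rightarrow> 'v::finite cvec set \<Rightarrow> bool" where
  "irreducible_mod T W \<longleftrightarrow> Tmodule T W \<and> W \<noteq> {0} \<and>
     \<not> (\<exists>U. Tmodule T U \<and> U \<noteq> {0} \<and> U \<subset> W)"

definition iso_mod :: "'v::finite cmat set \<Rightarrow> 'v::finite cvec set \<Rightarrow> 'v::finite cvec set \<Rightarrow> bool" where
  "iso_mod T W W' \<longleftrightarrow> (\<exists>f. bij_betw f W W' \<and>
     (\<forall>u\<in>W. \<forall>w\<in>W. f (u + w) = f u + f w) \<and> (\<forall>c. \<forall>u\<in>W. f (c *s u) = c *s f u) \<and>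
     (\<forall>M\<in>T. \<forall>w\<in>W. f (M *v w) = M *v f w))"

definition iso_class :: "'v::finite cmat set \<Rightarrow> 'v::finite cvec set \<Rightarrow> 'v::finite cvec set set" where
  "iso_class T W = {W'. irreducible_mod T W' \<and> iso_mod T W W'}"

definition mod_types :: "'v::finite cmat set \<Rightarrow> 'v::finite cvec set set set" where
  "mod_types T = {iso_class T W | W. irreducible_mod T W}"

definition rep :: "'v::finite cvec set set \<Rightarrow> 'v::finite cvec set" where
  "rep \<psi> = (SOME W. W \<in> \<psi>)"

definition Vtype :: "'v::finite cvec set set \<Rightarrow> 'v::finite cvec set" where
  "Vtype \<psi> = \<Inter> {U. csubspace U \<and> \<Union>\<psi> \<subseteq> U}"

definition eproj :: "'v::finite cmat set \<Rightarrow> 'v::finite cvec set set \<Rightarrow> 'v::finite cmat" where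
  "eproj T \<psi> = (THE P. (\<forall>v\<in>Vtype \<psi>. P *v v = v) \<and>
      (\<forall>\<mu>\<in>mod_types T. \<mu> \<noteq> \<psi> \<longrightarrow> (\<forall>v\<in>Vtype \<mu>. P *v v = 0)))"

definition opsum :: "'v::finite cmat set \<Rightarrow> ('v::finite cvec set set \<Rightarrow> complex) \<Rightarrow> 'v::finite cmat" where
  "opsum T f = (\<Sum>\<psi>\<in>mod_types T. smat (f \<psi>) (eproj T \<psi>))"

definition endpoint :: "(nat \<Rightarrow> 'v::finite cmat) \<Rightarrow> 'v::finite cvec set \<Rightarrow> nat" where
  "endpoint Es W = (LEAST i. \<exists>w\<in>W. Es i *v w \<noteq> 0)"

definition dual_endpoint :: "(nat \<Rightarrow> 'v::finite cmat) \<Rightarrow> 'v::finite cvec set \<Rightarrow> nat" where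
  "dual_endpoint E W = (LEAST i. \<exists>w\<in>W. E i *v w \<noteq> 0)"

definition mod_diam :: "(nat \<Rightarrow> 'v::finite cmat) \<Rightarrow> 'v::finite cvec set \<Rightarrow> nat" where
  "mod_diam Es W = card {i. \<exists>w\<in>W. Es i *v w \<noteq> 0} - 1"

text \<open>trace of the restriction of M to the M-invariant subspace W, computed as
  trace (M P) for a projection P onto W\<close>
definition restr_trace :: "'v::finite cmat \<Rightarrow> 'v::finite cvec set \<Rightarrow> complex" where
  "restr_trace M W = trace (M ** (SOME P. P ** P = P \<and> range (\<lambda>v. P *v v) = W))"

definition aW :: "complex \<Rightarrow> complex \<Rightarrow> nat \<Rightarrow> (nat \<Rightarrow> 'v::finite cmat) \<Rightarrow> (nat \<Rightarrow> 'v::finite cmat)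
    \<Rightarrow> 'v::finite cvec set \<Rightarrow> complex" where
  "aW a q D E Es W = a * q powi (2 * int (dual_endpoint E W) + int (mod_diam Es W) - int D)"

definition bW :: "complex \<Rightarrow> complex \<Rightarrow> nat \<Rightarrow> (nat \<Rightarrow> 'v::finite cmat)
    \<Rightarrow> 'v::finite cvec set \<Rightarrow> complex" where
  "bW b q D Es W = b * q powi (2 * int (endpoint Es W) + int (mod_diam Es W) - int D)"

definition kappaW :: "complex \<Rightarrow> complex \<Rightarrow> complex \<Rightarrow> nat \<Rightarrow> 'v::finite cmat
    \<Rightarrow> (nat \<Rightarrow> 'v::finite cmat) \<Rightarrow> (nat \<Rightarrow> 'v::finite cmat) \<Rightarrow> 'v::finite cvec set \<Rightarrow> complex" where
  "kappaW a b q D bA E Es W =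
    (let d = mod_diam Es W; \<rho> = endpoint Es W;
         aw = aW a q D E Es W; bw = bW b q D Es W;
         th = (\<lambda>i::nat. aw * q powi (2 * int i - int d) + inverse aw * q powi (int d - 2 * int i));
         ths = (\<lambda>i::nat. bw * q powi (2 * int i - int d) + inverse bw * q powi (int d - 2 * int i));
         \<phi>1 = (ths 0 - ths 1) * (restr_trace (Es \<rho> ** bA) W - th d)
     in if d = 0 then 0
        else aw / bw * q powi (int d - 1) + bw / aw * q powi (1 - int d)
             + \<phi>1 / ((q - inverse q) * (q powi int d - q powi (- int d))))"

end

theory Submission
  imports Defs
begin

text \<open>
  The right-hand sides of the three relations act on each isotypic component of \<open>V\<close> as scalars
  \<open>\<xi>\<close>, \<open>\<eta>\<close>, \<open>\<zeta>\<close>, and it suffices to show that these vanish. Neither thinness nor the theory of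
  Leonard systems is needed.

  Bipartiteness and the values \<open>\<theta>\<^sub>i\<^sup>*\<close> give
  \<open>A\<^sup>*\<^sup>2A - (q\<^sup>2 + q\<^sup>-\<^sup>2)A\<^sup>*AA\<^sup>* + AA\<^sup>*\<^sup>2 = v\<^sup>2(q\<^sup>2 - q\<^sup>-\<^sup>2)\<^sup>2A\<close> entrywise. Eliminating \<open>C\<close> from
  the first and third relations therefore leaves \<open>\<zeta>A\<^sup>*\<close> proportional to \<open>\<xi>\<close> on every component. On the
  module containing the base vertex, \<open>\<rho> = \<tau> = 0\<close> and \<open>d = D\<close> give \<open>\<xi> = \<eta> = 0\<close>, hence \<open>\<zeta> = 0\<close>; there the
  second relation forces the Krein parameters \<open>q\<^sup>i\<^sub>1\<^sub>i\<close> to vanish. Consequently \<open>E\<^sub>iA\<^sup>*E\<^sub>j = 0\<close>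
  unless \<open>\<bar>i - j\<bar> = 1\<close>, and the relation with the roles of \<open>A\<close> and \<open>A\<^sup>*\<close> exchanged holds too. So on
  every irreducible module also \<open>\<zeta>A\<close> is proportional to \<open>\<eta>\<close>. If \<open>\<zeta> \<noteq> 0\<close>, then \<open>A\<close> and \<open>A\<^sup>*\<close> act as scalars,
  which must be zero; then \<open>\<rho> = \<tau> = D/2\<close>, \<open>d = 0\<close>, and \<open>\<zeta> = 0\<close> after all.
\<close>

section \<open>Complex matrices acting on vectors\<close>

lemma smat_mv: "smat c M *v w = c *s (M *v w)"
  by (simp add: smat_def matrix_vector_mult_def vec_eq_iff sum_distrib_left mult.assoc)

lemma mv_scale: "(M :: 'v::finite cmat) *v (c *s w) = c *s (M *v w)"
  by (simp add: matrix_vector_mult_def vec_eq_iff sum_distrib_left algebra_simps)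

lemma mv_sum: "(M :: 'v::finite cmat) *v (\<Sum>i\<in>I. w i) = (\<Sum>i\<in>I. M *v w i)"
  by (induction I rule: infinite_finite_induct) (auto simp: matrix_vector_right_distrib)

lemma sum_mv: "(\<Sum>i\<in>I. M i :: 'v::finite cmat) *v w = (\<Sum>i\<in>I. M i *v w)"
  by (induction I rule: infinite_finite_induct) (auto simp: matrix_vector_mult_add_rdistrib)

lemma mv_assoc: "(M ** N) *v w = (M :: 'v::finite cmat) *v (N *v w)"
  by (simp add: matrix_vector_mul_assoc)

lemma matrix_add_rdistrib: "(M + N) ** K = M ** K + (N :: 'v::finite cmat) ** K"
  by (simp add: matrix_matrix_mult_def vec_eq_iff sum.distrib algebra_simps)

lemma matrix_diff_ldistrib: "M ** (N - K) = M ** N - (M :: 'v::finite cmat) ** K"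
  by (simp add: matrix_matrix_mult_def vec_eq_iff sum_subtractf algebra_simps)

lemma matrix_diff_rdistrib: "(M - N) ** K = M ** K - (N :: 'v::finite cmat) ** K"
  by (simp add: matrix_matrix_mult_def vec_eq_iff sum_subtractf algebra_simps)

lemma matrix_sum_ldistrib: "(M :: 'v::finite cmat) ** (\<Sum>i\<in>I. N i :: 'v cmat) = (\<Sum>i\<in>I. M ** N i)"
  by (induction I rule: infinite_finite_induct) (auto simp: matrix_add_ldistrib)

lemma matrix_sum_rdistrib: "(\<Sum>i\<in>I. N i :: 'v::finite cmat) ** (M :: 'v cmat) = (\<Sum>i\<in>I. N i ** M)"
  by (induction I rule: infinite_finite_induct) (auto simp: matrix_add_rdistrib)

lemma smat_mult_left: "smat c M ** N = smat c (M ** N)"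
  by (simp add: smat_def matrix_matrix_mult_def vec_eq_iff sum_distrib_left algebra_simps)

lemma scaleR_cvec: "(r *\<^sub>R u :: 'v::finite cvec) = of_real r *s u"
  unfolding vec_eq_iff vector_scaleR_component vector_smult_component
  by (simp add: scaleR_conv_of_real)

text \<open>\<open>inner\<close> on complex vectors is the real part of the Hermitian form, so a
  complex scalar crosses over conjugated.\<close>

lemma inner_cscale: "(c *s u) \<bullet> w = u \<bullet> (cnj c *s (w :: 'v::finite cvec))"
  by (simp add: inner_vec_def inner_complex_def algebra_simps sum.distrib)

definition cadj :: "'v::finite cmat \<Rightarrow> 'v cmat" where
  "cadj M = (\<chi> i j. cnj (M$j$i))"

lemma inner_cadj: "(M *v u) \<bullet> w = u \<bullet> (cadj M *v (w :: 'v::finite cvec))"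
proof -
  have inner_Re: "z \<bullet> z' = Re (z * cnj z')" for z z' :: complex
    by (simp add: inner_complex_def)
  have "(M *v u) \<bullet> w = Re (\<Sum>i\<in>UNIV. \<Sum>j\<in>UNIV. M$i$j * u$j * cnj (w$i))"
    by (simp add: inner_vec_def inner_Re matrix_vector_mult_def sum_distrib_right)
  also have "(\<Sum>i\<in>UNIV. \<Sum>j\<in>UNIV. M$i$j * u$j * cnj (w$i))
      = (\<Sum>j\<in>UNIV. \<Sum>i\<in>UNIV. M$i$j * u$j * cnj (w$i))"
    by (rule sum.swap)
  also have "Re \<dots> = u \<bullet> (cadj M *v w)"
    by (simp add: inner_vec_def inner_Re matrix_vector_mult_def cadj_def sum_distrib_left
        algebra_simps)
  finally show ?thesis .
qed

section \<open>Complex subspaces and orthogonal projections\<close>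

lemma csubspace_0: "csubspace W \<Longrightarrow> 0 \<in> W"
  and csubspace_add: "csubspace W \<Longrightarrow> u \<in> W \<Longrightarrow> w \<in> W \<Longrightarrow> u + w \<in> W"
  and csubspace_scale: "csubspace W \<Longrightarrow> u \<in> W \<Longrightarrow> c *s u \<in> W"
  by (auto simp: csubspace_def)

lemma csubspace_neg: "csubspace W \<Longrightarrow> u \<in> W \<Longrightarrow> - u \<in> W"
  using csubspace_scale[of W u "-1"] by simp

lemma csubspace_diff: "csubspace W \<Longrightarrow> u \<in> W \<Longrightarrow> w \<in> W \<Longrightarrow> u - w \<in> W"
  using csubspace_add[of W u "- w"] csubspace_neg[of W w] by simp

lemma csubspace_imp_subspace: "csubspace W \<Longrightarrow> subspace W"
  unfolding subspace_def by (auto simp: csubspace_0 csubspace_add csubspace_scale scaleR_cvec)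

definition perp :: "'v::finite cvec set \<Rightarrow> 'v cvec set" where
  "perp W = {v. \<forall>w\<in>W. v \<bullet> w = 0}"

lemma perp_mono: "U \<subseteq> W \<Longrightarrow> perp W \<subseteq> perp U"
  by (auto simp: perp_def)

text \<open>Real orthogonality suffices throughout: for a set closed under complex scalars, \<i>
  included, the real complement is also the Hermitian one.\<close>

lemma csubspace_perp:
  assumes "\<And>c u. u \<in> W \<Longrightarrow> c *s u \<in> W"
  shows "csubspace (perp W)"
  using assms by (auto simp: csubspace_def perp_def inner_add_left inner_cscale)

lemma perp_Int: "u \<in> W \<Longrightarrow> u \<in> perp W \<Longrightarrow> u = 0"
  by (auto simp: perp_def)

lemma perp_decomp:
  assumes "csubspace W"
  shows "\<exists>u. u \<in> W \<and> v - u \<in> perp W"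
proof -
  have sp: "span W = W"
    using assms csubspace_imp_subspace span_eq_iff by blast
  obtain y z where "y \<in> span W" "\<And>w. w \<in> span W \<Longrightarrow> orthogonal z w" "v = y + z"
    using orthogonal_subspace_decomp_exists[of W v] by blast
  then show ?thesis
    unfolding sp by (intro exI[of _ y]) (auto simp: perp_def orthogonal_def)
qed

definition oproj :: "'v::finite cvec set \<Rightarrow> 'v cvec \<Rightarrow> 'v cvec" where
  "oproj W v = (SOME u. u \<in> W \<and> v - u \<in> perp W)"

lemma
  assumes "csubspace W"
  shows oproj_in: "oproj W v \<in> W" and oproj_perp: "v - oproj W v \<in> perp W"
  using someI_ex[OF perp_decomp[OF assms, of v]] by (auto simp: oproj_def)

lemma oproj_eqI:
  assumes W: "csubspace W" and "u \<in> W" "v - u \<in> perp W"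
  shows "oproj W v = u"
proof -
  have "csubspace (perp W)"
    using W by (intro csubspace_perp csubspace_scale)
  then have "(v - u) - (v - oproj W v) \<in> perp W"
    by (rule csubspace_diff) (use assms oproj_perp in auto)
  moreover have "oproj W v - u \<in> W"
    using assms by (intro csubspace_diff oproj_in)
  ultimately show ?thesis
    using perp_Int[of "oproj W v - u" W] by simp
qed

lemma oproj_add:
  assumes W: "csubspace W" shows "oproj W (u + v) = oproj W u + oproj W v"
proof (rule oproj_eqI[OF W])
  have "csubspace (perp W)"
    using W by (intro csubspace_perp csubspace_scale)
  then have "(u - oproj W u) + (v - oproj W v) \<in> perp W"
    by (intro csubspace_add oproj_perp W)
  then show "u + v - (oproj W u + oproj W v) \<in> perp W"
    by (simp add: algebra_simps)
qed (auto intro: csubspace_add oproj_in W)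

lemma oproj_scale:
  assumes W: "csubspace W" shows "oproj W (c *s v) = c *s oproj W v"
proof (rule oproj_eqI[OF W])
  have "csubspace (perp W)"
    using W by (intro csubspace_perp csubspace_scale)
  then have "c *s (v - oproj W v) \<in> perp W"
    by (intro csubspace_scale oproj_perp W)
  then show "c *s v - c *s oproj W v \<in> perp W"
    by (simp add: vector_ssub_ldistrib)
qed (auto intro: csubspace_scale oproj_in W)

lemma oproj_matrix:
  assumes W: "csubspace (W :: 'v::finite cvec set)"
  shows "\<exists>P :: 'v cmat. \<forall>v. P *v v = oproj W v"
proof -
  have "Vector_Spaces.linear (*s) (*s) (oproj W)"
    by unfold_locales (auto simp: oproj_add oproj_scale W)
  then show ?thesis
    using matrix_works by blast
qed

section \<open>Modules over a self-adjoint set of matrices\<close>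

lemma Tmodule_csubspace: "Tmodule T W \<Longrightarrow> csubspace W"
  and Tmodule_mv: "Tmodule T W \<Longrightarrow> M \<in> T \<Longrightarrow> w \<in> W \<Longrightarrow> M *v w \<in> W"
  by (auto simp: Tmodule_def)

lemma irreducible_mod_Tmodule: "irreducible_mod T W \<Longrightarrow> Tmodule T W"
  by (simp add: irreducible_mod_def)

lemma irreducible_mod_cases:
  assumes "irreducible_mod T W" "Tmodule T U" "U \<subseteq> W"
  shows "U = {0} \<or> U = W"
  using assms by (auto simp: irreducible_mod_def)

lemma Tmodule_contains_irreducible:
  assumes "Tmodule T W" "W \<noteq> {0}"
  shows "\<exists>U\<subseteq>W. irreducible_mod T U"
  using assms
proof (induction "dim W" arbitrary: W rule: less_induct)
  case less
  show ?case
  proof (cases "irreducible_mod T W")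
    case False
    then obtain U where U: "Tmodule T U" "U \<noteq> {0}" "U \<subset> W"
      using less.prems by (auto simp: irreducible_mod_def)
    have "span U = U" "span W = W"
      using U less.prems by (auto simp: csubspace_imp_subspace Tmodule_csubspace)
    then have "dim U < dim W"
      using U dim_psubset by metis
    from less.hyps[OF this U(1,2)] U(3) show ?thesis
      by blast
  qed auto
qed

section \<open>Isomorphism of modules and the set of types\<close>

lemma iso_mod_refl: "iso_mod T W W"
  unfolding iso_mod_def by (rule exI[of _ "\<lambda>v. v"]) (auto simp: bij_betw_def)

lemma iso_mod_sym:
  assumes W: "Tmodule T W" and iso: "iso_mod T W W'"
  shows "iso_mod T W' W"
proof -
  obtain f where f: "bij_betw f W W'" "\<forall>u\<in>W. \<forall>w\<in>W. f (u + w) = f u + f w"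
    "\<forall>c. \<forall>u\<in>W. f (c *s u) = c *s f u" "\<forall>M\<in>T. \<forall>w\<in>W. f (M *v w) = M *v f w"
    using iso by (auto simp: iso_mod_def)
  define g where "g = inv_into W f"
  have g: "g v \<in> W" "f (g v) = v" if "v \<in> W'" for v
    using f(1) that unfolding g_def bij_betw_def
    by (auto intro: inv_into_into f_inv_into_f)
  have gf: "g (f w) = w" if "w \<in> W" for w
    using f(1) that by (auto simp: g_def bij_betw_def)
  have cs: "csubspace W" using W by (rule Tmodule_csubspace)
  have "bij_betw g W' W"
    using f(1) by (simp add: g_def bij_betw_inv_into)
  moreover have "g (u + w) = g u + g w" if "u \<in> W'" "w \<in> W'" for u w
    using gf[of "g u + g w"] f(2) g that cs by (simp add: csubspace_add)
  moreover have "g (c *s u) = c *s g u" if "u \<in> W'" for c u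
    using gf[of "c *s g u"] f(3) g that cs by (simp add: csubspace_scale)
  moreover have "g (M *v w) = M *v g w" if "M \<in> T" "w \<in> W'" for M w
    using gf[of "M *v g w"] f(4) g that W by (simp add: Tmodule_mv)
  ultimately show ?thesis
    unfolding iso_mod_def by blast
qed

lemma iso_mod_trans:
  assumes "iso_mod T W W'" "iso_mod T W' W''"
  shows "iso_mod T W W''"
proof -
  obtain f where f: "bij_betw f W W'" "\<forall>u\<in>W. \<forall>w\<in>W. f (u + w) = f u + f w"
    "\<forall>c. \<forall>u\<in>W. f (c *s u) = c *s f u" "\<forall>M\<in>T. \<forall>w\<in>W. f (M *v w) = M *v f w"
    using assms by (auto simp: iso_mod_def)
  obtain g where g: "bij_betw g W' W''" "\<forall>u\<in>W'. \<forall>w\<in>W'. g (u + w) = g u + g w"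
    "\<forall>c. \<forall>u\<in>W'. g (c *s u) = c *s g u" "\<forall>M\<in>T. \<forall>w\<in>W'. g (M *v w) = M *v g w"
    using assms by (auto simp: iso_mod_def)
  have fW: "f w \<in> W'" if "w \<in> W" for w
    using f(1) that by (auto simp: bij_betw_def)
  show ?thesis
    unfolding iso_mod_def
    by (rule exI[of _ "g \<circ> f"]) (use f g fW in \<open>auto intro: bij_betw_trans\<close>)
qed

text \<open>Used contrapositively, to carry nonvanishing of an element of \<open>T\<close> from any
  module of a type to the chosen representative \<open>rep\<close>.\<close>

lemma iso_mod_vanish:
  assumes W: "Tmodule T W" and iso: "iso_mod T W W'" and M: "M \<in> T"
    and M0: "\<forall>w\<in>W'. M *v w = 0"
  shows "\<forall>w\<in>W. M *v w = 0"
proof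
  fix w assume w: "w \<in> W"
  obtain f where f: "bij_betw f W W'" "\<forall>c. \<forall>u\<in>W. f (c *s u) = c *s f u"
      "\<forall>M\<in>T. \<forall>w\<in>W. f (M *v w) = M *v f w"
    using iso by (auto simp: iso_mod_def)
  have W0: "0 \<in> W" and MW: "M *v w \<in> W"
    using W M w by (auto simp: csubspace_0 Tmodule_csubspace Tmodule_mv)
  have "f 0 = 0"
    using f(2)[rule_format, of 0 0] W0 by simp
  moreover have "f w \<in> W'" using f(1) w by (auto simp: bij_betw_def)
  then have "f (M *v w) = 0" using f(3) M w M0 by simp
  ultimately show "M *v w = 0"
    using f(1) W0 MW by (metis bij_betw_def inj_onD)
qed

lemma mem_mod_types_irreducible: "\<psi> \<in> mod_types T \<Longrightarrow> W \<in> \<psi> \<Longrightarrow> irreducible_mod T W"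
  by (auto simp: mod_types_def iso_class_def)

lemma mem_mod_types_iso:
  assumes "\<psi> \<in> mod_types T" "W \<in> \<psi>" "W' \<in> \<psi>"
  shows "iso_mod T W W'"
  using assms unfolding mod_types_def iso_class_def
  by (auto intro: iso_mod_trans iso_mod_sym irreducible_mod_Tmodule)

lemma iso_class_mod_types: "irreducible_mod T W \<Longrightarrow> iso_class T W \<in> mod_types T"
  by (auto simp: mod_types_def)

lemma iso_class_self: "irreducible_mod T W \<Longrightarrow> W \<in> iso_class T W"
  by (simp add: iso_class_def iso_mod_refl)

lemma rep_mem: "\<psi> \<in> mod_types T \<Longrightarrow> rep \<psi> \<in> \<psi>"
  unfolding rep_def by (rule someI_ex) (auto simp: mod_types_def intro: iso_class_self)

lemma mod_types_disjoint:
  assumes "\<psi> \<in> mod_types T" "\<mu> \<in> mod_types T" "W \<in> \<psi>" "W' \<in> \<mu>" "iso_mod T W W'"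
  shows "\<psi> = \<mu>"
proof -
  obtain U where U: "irreducible_mod T U" "\<psi> = iso_class T U"
    using assms(1) by (auto simp: mod_types_def)
  obtain U' where U': "irreducible_mod T U'" "\<mu> = iso_class T U'"
    using assms(2) by (auto simp: mod_types_def)
  have "iso_mod T U W" "iso_mod T U' W'" "irreducible_mod T W'" "irreducible_mod T W"
    using assms U U' by (auto simp: iso_class_def)
  then have "iso_mod T U U'" "iso_mod T U' U"
    using assms(5) U U' iso_mod_trans iso_mod_sym irreducible_mod_Tmodule by metis+
  then show ?thesis
    unfolding U(2) U'(2) iso_class_def using iso_mod_trans by blast
qed

section \<open>Isotypic components\<close>

lemma csubspace_Vtype: "csubspace (Vtype \<psi>)"
  unfolding Vtype_def csubspace_def by blast

lemma Vtype_superset: "W \<in> \<psi> \<Longrightarrow> W \<subseteq> Vtype \<psi>"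
  by (auto simp: Vtype_def)

lemma Vtype_least: "csubspace U \<Longrightarrow> \<Union>\<psi> \<subseteq> U \<Longrightarrow> Vtype \<psi> \<subseteq> U"
  by (auto simp: Vtype_def)

text \<open>Closure under the conjugate transpose makes the complement of a submodule a submodule;
  this is the source of complete reducibility.\<close>

locale selfadjoint_matrices =
  fixes T :: "'v::finite cmat set"
  assumes cadj_closed: "M \<in> T \<Longrightarrow> cadj M \<in> T"
begin

lemma Tmodule_perp:
  assumes "\<And>c u. u \<in> W \<Longrightarrow> c *s u \<in> W" "\<And>M u. M \<in> T \<Longrightarrow> u \<in> W \<Longrightarrow> M *v u \<in> W"
  shows "Tmodule T (perp W)"
  unfolding Tmodule_def
proof (intro conjI ballI)
  show "csubspace (perp W)"
    using assms by (intro csubspace_perp)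
  fix M v assume "M \<in> T" "v \<in> perp W"
  then show "M *v v \<in> perp W"
    using assms(2) cadj_closed by (auto simp: perp_def inner_cadj)
qed

text \<open>\<open>W\<close> and \<open>perp W\<close> are both submodules, so \<open>M\<close> maps
  the decomposition of \<open>v\<close> to that of \<open>M *v v\<close>.\<close>

lemma oproj_commute:
  assumes W: "Tmodule T W" and M: "M \<in> T"
  shows "oproj W (M *v v) = M *v oproj W v"
proof (rule oproj_eqI)
  show cs: "csubspace W" using W by (rule Tmodule_csubspace)
  show "M *v oproj W v \<in> W"
    using W M oproj_in[OF cs] by (auto intro: Tmodule_mv)
  have "Tmodule T (perp W)"
    using W cs by (intro Tmodule_perp csubspace_scale Tmodule_mv)
  then have "M *v (v - oproj W v) \<in> perp W"
    using M oproj_perp[OF cs] by (intro Tmodule_mv)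
  then show "M *v v - M *v oproj W v \<in> perp W"
    by (simp add: matrix_vector_mult_diff_distrib)
qed

text \<open>Schur's lemma for the orthogonal projection onto \<open>W'\<close> restricted to
  \<open>W\<close>: its kernel \<open>K\<close> and its image are submodules, so it is zero or an
  isomorphism.\<close>

lemma irreducible_orthogonal:
  assumes W: "irreducible_mod T W" and W': "irreducible_mod T W'" and niso: "\<not> iso_mod T W W'"
  shows "W \<subseteq> perp W'"
proof -
  note mW = irreducible_mod_Tmodule[OF W] and mW' = irreducible_mod_Tmodule[OF W']
  note cW = Tmodule_csubspace[OF mW] and cW' = Tmodule_csubspace[OF mW']
  define K where "K = {w\<in>W. oproj W' w = 0}"
  have o0: "oproj W' 0 = 0"
    using oproj_scale[OF cW', of 0 0] by simp
  have "Tmodule T K"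
    unfolding Tmodule_def csubspace_def K_def
    using cW mW mW' cW' o0
    by (auto simp: csubspace_0 csubspace_add csubspace_scale oproj_add oproj_scale
        Tmodule_mv oproj_commute)
  then consider "K = {0}" | "K = W"
    using irreducible_mod_cases[OF W, of K] by (auto simp: K_def)
  then show ?thesis
  proof cases
    case 1
    have inj: "inj_on (oproj W') W"
    proof (rule inj_onI)
      fix u w assume uw: "u \<in> W" "w \<in> W" "oproj W' u = oproj W' w"
      have "oproj W' (u + (-1) *s w) = 0"
        using uw cW' by (simp only: oproj_add oproj_scale) simp
      moreover have "u + (-1) *s w \<in> W"
        using uw cW by (intro csubspace_add csubspace_scale)
      ultimately have "u + (-1) *s w \<in> K" by (simp add: K_def)
      then show "u = w" using 1 by simp
    qed
    have "Tmodule T (oproj W' ` W)"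
      unfolding Tmodule_def csubspace_def
    proof (intro conjI ballI allI)
      show "0 \<in> oproj W' ` W"
        using o0 cW by (metis csubspace_0 imageI)
    next
      fix u w assume "u \<in> oproj W' ` W" "w \<in> oproj W' ` W"
      then show "u + w \<in> oproj W' ` W"
        using cW cW' by (auto simp: csubspace_add simp flip: oproj_add)
    next
      fix c u assume "u \<in> oproj W' ` W"
      then show "c *s u \<in> oproj W' ` W"
        using cW cW' by (auto simp: csubspace_scale simp flip: oproj_scale)
    next
      fix M w assume "M \<in> T" "w \<in> oproj W' ` W"
      then show "M *v w \<in> oproj W' ` W"
        using mW mW' by (auto simp: Tmodule_mv simp flip: oproj_commute)
    qed
    moreover have "oproj W' ` W \<subseteq> W'"
      using oproj_in[OF cW'] by auto
    moreover have "oproj W' ` W \<noteq> {0}"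
    proof
      assume "oproj W' ` W = {0}"
      then have "W \<subseteq> K" by (auto simp: K_def)
      then show False using 1 W by (auto simp: irreducible_mod_def K_def)
    qed
    ultimately have "oproj W' ` W = W'"
      using irreducible_mod_cases[OF W'] by blast
    then have "iso_mod T W W'"
      unfolding iso_mod_def bij_betw_def using inj mW' cW'
      by (intro exI[of _ "oproj W'"]) (auto simp: oproj_add oproj_scale oproj_commute)
    then show ?thesis using niso by simp
  next
    case 2
    show ?thesis
    proof
      fix w assume "w \<in> W"
      then have "oproj W' w = 0" using 2 by (auto simp: K_def)
      then show "w \<in> perp W'" using oproj_perp[OF cW', of w] by simp
    qed
  qed
qed

lemma Vtype_orthogonal:
  assumes "\<psi> \<in> mod_types T" "\<mu> \<in> mod_types T" "\<psi> \<noteq> \<mu>"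
  shows "Vtype \<psi> \<subseteq> perp (Vtype \<mu>)"
proof -
  have perp_sym: "U \<subseteq> perp W \<Longrightarrow> W \<subseteq> perp U" for U W :: "'v cvec set"
    unfolding perp_def by (subst (asm) inner_commute) blast
  have *: "W \<subseteq> perp W'" if "W \<in> \<psi>" "W' \<in> \<mu>" for W W'
    using that assms mod_types_disjoint mem_mod_types_irreducible irreducible_orthogonal
    by metis
  have cs: "csubspace (perp W)" if "W \<in> \<psi> \<or> W \<in> \<mu>" for W
    using that assms
    by (intro csubspace_perp csubspace_scale)
      (auto dest: mem_mod_types_irreducible intro: irreducible_mod_Tmodule Tmodule_csubspace)
  have "Vtype \<psi> \<subseteq> perp W'" if "W' \<in> \<mu>" for W'
    using * that cs by (intro Vtype_least) auto
  then have "W' \<subseteq> perp (Vtype \<psi>)" if "W' \<in> \<mu>" for W'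
    using that perp_sym by blast
  moreover have "csubspace (perp (Vtype \<psi>))"
    by (intro csubspace_perp csubspace_scale csubspace_Vtype)
  ultimately have "Vtype \<mu> \<subseteq> perp (Vtype \<psi>)"
    by (intro Vtype_least) auto
  then show ?thesis by (rule perp_sym)
qed

text \<open>The complement of all irreducible modules is a module; an irreducible part of it would
  be orthogonal to itself, so it is zero.\<close>

lemma irreducible_generate:
  assumes U: "csubspace U" and irr: "\<And>W. irreducible_mod T W \<Longrightarrow> W \<subseteq> U"
  shows "v \<in> U"
proof -
  \<comment> \<open>\<open>S\<close> is a bare union and need not be a subspace;
    \<open>Tmodule_perp\<close> asks only for closure under scalars and under
    \<open>T\<close>.\<close>
  define S where "S = \<Union>{W. irreducible_mod T W}"
  have "Tmodule T (perp S)"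
    by (rule Tmodule_perp)
      (auto simp: S_def, (meson irreducible_mod_Tmodule csubspace_scale Tmodule_csubspace
        Tmodule_mv)+)
  moreover have False if W: "W \<subseteq> perp S" "irreducible_mod T W" for W
  proof -
    have "w = 0" if "w \<in> W" for w
      using that W by (intro perp_Int[of w S]) (auto simp: S_def)
    then show False
      using W(2) csubspace_0[OF Tmodule_csubspace[OF irreducible_mod_Tmodule[OF W(2)]]]
      by (auto simp: irreducible_mod_def)
  qed
  ultimately have "perp S = {0}"
    using Tmodule_contains_irreducible by blast
  moreover have "S \<subseteq> U" using irr by (auto simp: S_def)
  ultimately have "perp U \<subseteq> {0}"
    using perp_mono by blast
  then have "v - oproj U v = 0"
    using oproj_perp[OF U, of v] by blast
  then show ?thesis
    using oproj_in[OF U, of v] by simp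
qed

lemma csubspace_eq: "csubspace {v. (M :: 'v cmat) *v v = N *v v}"
  by (auto simp: csubspace_def matrix_vector_right_distrib mv_scale)

lemma matrix_eq_on_irreducible:
  assumes "\<And>\<psi> v. \<psi> \<in> mod_types T \<Longrightarrow> v \<in> Vtype \<psi> \<Longrightarrow> M *v v = N *v v"
  shows "(M :: 'v cmat) = N"
proof -
  have "M *v v = N *v v" for v
    using irreducible_generate[OF csubspace_eq, of M N v] assms Vtype_superset
      iso_class_mod_types iso_class_self by blast
  then show ?thesis by (simp add: matrix_eq)
qed

text \<open>Orthogonal projection onto \<open>Vtype \<psi>\<close> shows existence; uniqueness holds
  because the isotypic components generate the whole space.\<close>

lemma eproj_works:
  assumes psi: "\<psi> \<in> mod_types T"
  shows "(\<forall>v\<in>Vtype \<psi>. eproj T \<psi> *v v = v) \<and>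
      (\<forall>\<mu>\<in>mod_types T. \<mu> \<noteq> \<psi> \<longrightarrow> (\<forall>v\<in>Vtype \<mu>. eproj T \<psi> *v v = 0))"
  unfolding eproj_def
proof (rule theI')
  obtain P :: "'v cmat" where P: "P *v v = oproj (Vtype \<psi>) v" for v
    using oproj_matrix[OF csubspace_Vtype] by blast
  let ?Q = "\<lambda>P. (\<forall>v\<in>Vtype \<psi>. P *v v = v) \<and>
      (\<forall>\<mu>\<in>mod_types T. \<mu> \<noteq> \<psi> \<longrightarrow> (\<forall>v\<in>Vtype \<mu>. P *v v = 0))"
  have QP: "?Q P"
    proof (intro conjI ballI impI)
      fix v assume "v \<in> Vtype \<psi>"
      then show "P *v v = v"
        unfolding P by (intro oproj_eqI csubspace_Vtype) (auto simp: perp_def)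
    next
      fix \<mu> v assume "\<mu> \<in> mod_types T" "\<mu> \<noteq> \<psi>" "v \<in> Vtype \<mu>"
      then show "P *v v = 0"
        using Vtype_orthogonal[of \<mu> \<psi>] psi unfolding P
        by (intro oproj_eqI) (auto simp: csubspace_Vtype csubspace_0)
    qed
  show "\<exists>!P. ?Q P"
  proof (rule ex1I, rule QP)
    fix P' assume P': "?Q P'"
    show "P' = P"
    proof (rule matrix_eq_on_irreducible)
      fix \<mu> v assume "\<mu> \<in> mod_types T" "v \<in> Vtype \<mu>"
      then show "P' *v v = P *v v"
        using P' QP by (cases "\<mu> = \<psi>") auto
    qed
  qed
qed

text \<open>Nonzero vectors picked from distinct types are pairwise orthogonal, hence independent.
  Finiteness matters because \<open>opsum\<close> sums over this set.\<close>

lemma finite_mod_types: "finite (mod_types T)"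
proof -
  have "\<exists>w\<in>rep \<psi>. w \<noteq> 0" if "\<psi> \<in> mod_types T" for \<psi>
  proof -
    have W: "irreducible_mod T (rep \<psi>)"
      using that rep_mem mem_mod_types_irreducible by blast
    then show ?thesis
      using csubspace_0[OF Tmodule_csubspace[OF irreducible_mod_Tmodule[OF W]]]
      by (auto simp: irreducible_mod_def)
  qed
  then obtain g where g: "g \<psi> \<in> rep \<psi>" "g \<psi> \<noteq> 0" if "\<psi> \<in> mod_types T" for \<psi>
    by metis
  have gV: "g \<psi> \<in> Vtype \<psi>" if "\<psi> \<in> mod_types T" for \<psi>
    using g(1)[OF that] rep_mem[OF that] Vtype_superset by blast
  have orth: "g \<psi> \<bullet> g \<mu> = 0" if "\<psi> \<in> mod_types T" "\<mu> \<in> mod_types T" "\<psi> \<noteq> \<mu>" for \<psi> \<mu>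
    using Vtype_orthogonal[OF that] gV that by (auto simp: perp_def)
  have "inj_on g (mod_types T)"
    using orth g(2) by (metis inj_onI inner_eq_zero_iff)
  moreover have "finite (g ` mod_types T)"
  proof (rule independent_imp_finite, rule pairwise_orthogonal_independent)
    show "pairwise orthogonal (g ` mod_types T)"
      using orth by (auto simp: pairwise_def orthogonal_def)
    show "0 \<notin> g ` mod_types T"
      using g(2) by auto
  qed
  ultimately show ?thesis
    using finite_imageD by blast
qed

lemma opsum_mv:
  assumes "\<psi> \<in> mod_types T" "v \<in> Vtype \<psi>"
  shows "opsum T f *v v = f \<psi> *s v"
proof -
  have "opsum T f *v v = (\<Sum>\<mu>\<in>mod_types T. f \<mu> *s (eproj T \<mu> *v v))"
    by (simp add: opsum_def sum_mv smat_mv)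
  also have "\<dots> = (\<Sum>\<mu>\<in>mod_types T. if \<mu> = \<psi> then f \<psi> *s v else 0)"
    using assms eproj_works by (intro sum.cong) auto
  finally show ?thesis
    using assms by (simp add: finite_mod_types)
qed

end

section \<open>Distances in a bipartite distance-regular graph\<close>

lemma relpow_sym:
  assumes "\<And>u w. (u, w) \<in> R \<Longrightarrow> (w, u) \<in> R"
  shows "(u, w) \<in> R ^^ n \<Longrightarrow> (w, u) \<in> R ^^ n"
proof (induction n arbitrary: w)
  case (Suc n)
  then obtain v where "(u, v) \<in> R ^^ n" "(v, w) \<in> R" by auto
  then show ?case using Suc.IH[of v] assms[of v w] by (intro relpow_Suc_I2)
qed simp

locale bipartite_drg =
  fixes adj :: "'v::finite \<Rightarrow> 'v \<Rightarrow> bool"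
  assumes simple: "simple_graph adj" and conn: "connected_graph adj"
    and dreg: "distance_regular adj" and bip: "bipartite adj"
begin

abbreviation "dist\<^sub>G \<equiv> gdist adj"
abbreviation "A \<equiv> Amat adj"

lemma adj_sym: "adj u w \<Longrightarrow> adj w u"
  using simple by (auto simp: simple_graph_def)

lemma gdist_walk: "(u, w) \<in> adjrel adj ^^ dist\<^sub>G u w"
proof -
  have "\<exists>n. (u, w) \<in> adjrel adj ^^ n"
    using conn by (simp add: connected_graph_def)
  then show ?thesis unfolding gdist_def by (rule LeastI_ex)
qed

lemma gdist_le: "(u, w) \<in> adjrel adj ^^ n \<Longrightarrow> dist\<^sub>G u w \<le> n"
  unfolding gdist_def by (rule Least_le)

lemma gdist_eq_0 [simp]: "dist\<^sub>G u w = 0 \<longleftrightarrow> u = w"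
  using gdist_walk[of u w] gdist_le[of u w 0] by auto

lemma gdist_self [simp]: "dist\<^sub>G u u = 0"
  by simp

lemma gdist_commute: "dist\<^sub>G u w = dist\<^sub>G w u"
proof -
  have "dist\<^sub>G u w \<le> dist\<^sub>G w u" for u w
    by (rule gdist_le, rule relpow_sym[OF _ gdist_walk]) (auto simp: adjrel_def adj_sym)
  then show ?thesis by (simp add: order_antisym)
qed

lemma gdist_adj_le: "adj y z \<Longrightarrow> dist\<^sub>G x z \<le> Suc (dist\<^sub>G x y)"
  by (rule gdist_le, rule relpow_Suc_I[OF gdist_walk]) (simp add: adjrel_def)

text \<open>The parity of a walk is fixed by the sides of its ends in the bipartition, so adjacent
  vertices are never equally far from \<open>x\<close>.\<close>

lemma gdist_adj:
  assumes "adj y z"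
  shows "dist\<^sub>G x z = Suc (dist\<^sub>G x y) \<or> dist\<^sub>G x y = Suc (dist\<^sub>G x z)"
proof -
  obtain S where S: "\<And>u w. adj u w \<Longrightarrow> u \<in> S \<longleftrightarrow> w \<notin> S"
    using bip by (auto simp: bipartite_def)
  have "even n \<longleftrightarrow> (u \<in> S \<longleftrightarrow> w \<in> S)" if "(u, w) \<in> adjrel adj ^^ n" for u w n
    using that
  proof (induction n arbitrary: w)
    case (Suc n)
    then obtain v where "(u, v) \<in> adjrel adj ^^ n" "adj v w"
      by (auto simp: adjrel_def)
    then show ?case using Suc.IH[of v] S[of v w] by auto
  qed simp
  from this[OF gdist_walk] have "even (dist\<^sub>G x w) \<longleftrightarrow> (x \<in> S \<longleftrightarrow> w \<in> S)" for w
    by blast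
  from this[of y] this[of z] have "dist\<^sub>G x y \<noteq> dist\<^sub>G x z"
    using S[OF assms] by auto
  then show ?thesis
    using gdist_adj_le[OF assms, of x] gdist_adj_le[OF adj_sym[OF assms], of x] by linarith
qed

lemma gdist_SucE:
  assumes "dist\<^sub>G x y = Suc n"
  obtains z where "adj z y" "dist\<^sub>G x z = n"
proof -
  obtain z where "(x, z) \<in> adjrel adj ^^ n" "adj z y"
    using gdist_walk[of x y] unfolding assms by (auto simp: adjrel_def)
  then show ?thesis
    using that[of z] gdist_le[of x z n] gdist_adj_le[of z y x] assms by auto
qed

lemma gdist_le_diam: "dist\<^sub>G u w \<le> diam adj"
proof -
  have "finite {dist\<^sub>G u w | u w. True}"
    by (rule finite_subset[of _ "range (\<lambda>(u, w). dist\<^sub>G u w)"]) auto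
  then show ?thesis unfolding diam_def by (intro Max_ge) auto
qed

text \<open>Sphere sizes do not depend on the centre, so every \<open>x\<close> has a vertex at
  distance \<open>diam adj\<close>; geodesics supply the smaller distances.\<close>

lemma ex_gdist_eq:
  assumes "i \<le> diam adj" shows "\<exists>y. dist\<^sub>G x y = i"
  using assms
proof (induction rule: inc_induct)
  case base
  have fin: "finite {dist\<^sub>G u w | u w. True}"
    by (rule finite_subset[of _ "range (\<lambda>(u, w). dist\<^sub>G u w)"]) auto
  have "diam adj \<in> {dist\<^sub>G u w | u w. True}"
    unfolding diam_def using fin by (intro Max_in) auto
  then obtain u w where uw: "dist\<^sub>G u w = diam adj" by auto
  obtain p :: "nat \<Rightarrow> nat \<Rightarrow> nat \<Rightarrow> nat" where
    "\<And>u w i j. card {z. dist\<^sub>G u z = i \<and> dist\<^sub>G w z = j} = p i j (dist\<^sub>G u w)"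
    using dreg by (auto simp: distance_regular_def)
  from this[of u i u i for i] this[of x i x i for i]
  have "card {z. dist\<^sub>G u z = i} = card {z. dist\<^sub>G x z = i}" for i by simp
  moreover have "card {z. dist\<^sub>G u z = diam adj} \<noteq> 0" using uw by auto
  ultimately have "card {z. dist\<^sub>G x z = diam adj} \<noteq> 0" by simp
  then show ?case by (auto simp: card_gt_0_iff)
next
  case (step n)
  then obtain y where "dist\<^sub>G x y = Suc n" by blast
  then show ?case by (rule gdist_SucE) blast
qed

section \<open>The Bose-Mesner algebra\<close>

lemma BM_iff: "M \<in> BM adj \<longleftrightarrow> (\<exists>c. \<forall>y z. M$y$z = c (dist\<^sub>G y z))"
proof -
  have *: "(\<Sum>i\<le>diam adj. smat (c i) (distmat adj i)) $ y $ z = c (dist\<^sub>G y z)" for c y z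
    using gdist_le_diam[of y z]
    by (simp add: smat_def distmat_def if_distrib cong: if_cong)
  show ?thesis
  proof
    assume "M \<in> BM adj"
    then show "\<exists>c. \<forall>y z. M$y$z = c (dist\<^sub>G y z)"
      unfolding BM_def using * by blast
  next
    assume "\<exists>c. \<forall>y z. M$y$z = c (dist\<^sub>G y z)"
    then obtain c where c: "\<forall>y z. M$y$z = c (dist\<^sub>G y z)" by blast
    then have "M = (\<Sum>i\<le>diam adj. smat (c i) (distmat adj i))"
      unfolding vec_eq_iff using *[of c] by simp
    then show "M \<in> BM adj" unfolding BM_def by blast
  qed
qed

lemma BM_one: "mat 1 \<in> BM adj"
  unfolding BM_iff by (rule exI[of _ "\<lambda>i. if i = 0 then 1 else 0"]) (auto simp: mat_def)

lemma BM_diff: "M \<in> BM adj \<Longrightarrow> N \<in> BM adj \<Longrightarrow> M - N \<in> BM adj"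
proof -
  assume "M \<in> BM adj" "N \<in> BM adj"
  then obtain c e where "\<forall>y z. M$y$z = c (dist\<^sub>G y z)" "\<forall>y z. N$y$z = e (dist\<^sub>G y z)"
    unfolding BM_iff by blast
  then show ?thesis
    unfolding BM_iff by (intro exI[of _ "\<lambda>i. c i - e i"]) simp
qed

lemma BM_0: "0 \<in> BM adj"
  using BM_diff[OF BM_one BM_one] by simp

lemma BM_add: "M \<in> BM adj \<Longrightarrow> N \<in> BM adj \<Longrightarrow> M + N \<in> BM adj"
  using BM_diff[of M "0 - N"] BM_diff[of 0 N] BM_0 by simp

lemma BM_sum: "(\<And>i. i \<in> I \<Longrightarrow> M i \<in> BM adj) \<Longrightarrow> (\<Sum>i\<in>I. M i) \<in> BM adj"
  by (induction I rule: infinite_finite_induct) (auto simp: BM_0 BM_add)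

lemma BM_sym: "M \<in> BM adj \<Longrightarrow> M$y$z = M$z$y"
proof -
  assume "M \<in> BM adj"
  then obtain c where "\<forall>y z. M$y$z = c (dist\<^sub>G y z)"
    unfolding BM_iff by blast
  then show ?thesis using gdist_commute[of y z] by simp
qed

lemma BM_mult:
  assumes "M \<in> BM adj" "N \<in> BM adj"
  shows "M ** N \<in> BM adj"
proof -
  obtain c e where c: "\<And>y z. M$y$z = c (dist\<^sub>G y z)" and e: "\<And>y z. N$y$z = e (dist\<^sub>G y z)"
    using assms unfolding BM_iff by blast
  obtain p :: "nat \<Rightarrow> nat \<Rightarrow> nat \<Rightarrow> nat" where
    p: "\<And>u w i j. card {z. dist\<^sub>G u z = i \<and> dist\<^sub>G w z = j} = p i j (dist\<^sub>G u w)"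
    using dreg by (auto simp: distance_regular_def)
  let ?I = "{..diam adj} \<times> {..diam adj}"
  have "(M ** N)$y$z = (\<Sum>(i, j)\<in>?I. of_nat (p i j (dist\<^sub>G y z)) * (c i * e j))" for y z
  proof -
    have "(M ** N)$y$z = (\<Sum>w\<in>UNIV. c (dist\<^sub>G y w) * e (dist\<^sub>G z w))"
      by (simp add: matrix_matrix_mult_def c e gdist_commute)
    \<comment> \<open>Intermediate vertices are grouped by their distances to \<open>y\<close> and
      \<open>z\<close>; the group sizes are intersection numbers.\<close>
    also have "\<dots> = (\<Sum>k\<in>?I. \<Sum>w\<in>{w\<in>UNIV. (dist\<^sub>G y w, dist\<^sub>G z w) = k}.
        c (dist\<^sub>G y w) * e (dist\<^sub>G z w))"
      by (rule sum.group[symmetric]) (auto simp: gdist_le_diam)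
    also have "\<dots> = (\<Sum>(i, j)\<in>?I. of_nat (p i j (dist\<^sub>G y z)) * (c i * e j))"
      by (rule sum.cong) (auto simp: p[symmetric])
    finally show ?thesis .
  qed
  then show ?thesis
    unfolding BM_iff
    by (intro exI[of _ "\<lambda>h. \<Sum>(i, j)\<in>?I. of_nat (p i j h) * (c i * e j)"]) simp
qed

text \<open>Both factors and their product are symmetric matrices.\<close>

lemma BM_commute:
  assumes "M \<in> BM adj" "N \<in> BM adj"
  shows "M ** N = N ** M"
proof -
  have "(M ** N)$y$z = (N ** M)$y$z" for y z
  proof -
    have "(M ** N)$y$z = (M ** N)$z$y"
      using BM_sym[OF BM_mult[OF assms]] .
    also have "\<dots> = (N ** M)$y$z"
      using BM_sym[OF assms(1)] BM_sym[OF assms(2)]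
      by (simp add: matrix_matrix_mult_def mult.commute)
    finally show ?thesis .
  qed
  then show ?thesis by (simp add: vec_eq_iff)
qed

lemma BM_hadamard:
  assumes "M \<in> BM adj" "N \<in> BM adj"
  shows "hadamard M N \<in> BM adj"
proof -
  obtain c e where "\<forall>y z. M$y$z = c (dist\<^sub>G y z)" "\<forall>y z. N$y$z = e (dist\<^sub>G y z)"
    using assms unfolding BM_iff by blast
  then show ?thesis
    unfolding BM_iff by (intro exI[of _ "\<lambda>i. c i * e i"]) (simp add: hadamard_def)
qed

text \<open>The column of \<open>x\<close> meets every distance that occurs, so it determines a
  matrix whose entries depend only on distance.\<close>

lemma BM_column_eq_0:
  assumes "M \<in> BM adj" "\<And>y. M$y$x = 0"
  shows "M = 0"
proof -
  obtain c where c: "\<And>y z. M$y$z = c (dist\<^sub>G y z)"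
    using assms unfolding BM_iff by blast
  have "c (dist\<^sub>G y z) = 0" for y z
  proof -
    obtain w where "dist\<^sub>G x w = dist\<^sub>G y z"
      using ex_gdist_eq[OF gdist_le_diam] by blast
    then show ?thesis using assms(2)[of w] c[of w x] gdist_commute[of w x] by simp
  qed
  then show ?thesis by (simp add: vec_eq_iff c)
qed

section \<open>Primitive idempotents under a given idempotent\<close>

lemma csubspace_range: "csubspace (range (\<lambda>v. (M :: 'v cmat) *v v))"
  unfolding csubspace_def
proof (intro conjI ballI allI)
  show "0 \<in> range (\<lambda>v. M *v v)" by (rule range_eqI[of _ _ 0]) simp
next
  fix u w assume "u \<in> range (\<lambda>v. M *v v)" "w \<in> range (\<lambda>v. M *v v)"
  then obtain u' w' where "u = M *v u'" "w = M *v w'" by blast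
  then show "u + w \<in> range (\<lambda>v. M *v v)"
    by (intro range_eqI[of _ _ "u' + w'"]) (simp add: matrix_vector_right_distrib)
next
  fix c u assume "u \<in> range (\<lambda>v. M *v v)"
  then obtain u' where "u = M *v u'" by blast
  then show "c *s u \<in> range (\<lambda>v. M *v v)"
    by (intro range_eqI[of _ _ "c *s u'"]) (simp add: mv_scale)
qed

lemma span_range_mv: "span (range (\<lambda>v. (M :: 'v cmat) *v v)) = range (\<lambda>v. M *v v)"
  by (rule span_eq_iff[THEN iffD2, OF csubspace_imp_subspace[OF csubspace_range]])

text \<open>If \<open>F\<close> splits as \<open>G + H\<close>, a nonzero \<open>H *v v\<close> lies
  in the range of \<open>F\<close> but not in that of \<open>G\<close>, so the real dimension of the
  range drops.\<close>

lemma idempotent_above_primitive: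
  assumes "F \<in> BM adj" "F ** F = F" "F \<noteq> 0"
  shows "\<exists>P. prim_idem (BM adj) P \<and> P ** F = P"
  using assms
proof (induction "dim (range (\<lambda>v. F *v v))" arbitrary: F rule: less_induct)
  case less
  show ?case
  proof (cases "prim_idem (BM adj) F")
    case True
    then show ?thesis using less.prems by blast
  next
    case False
    then obtain G H where GH: "G \<in> BM adj" "H \<in> BM adj" "G ** G = G" "H ** H = H"
      "G \<noteq> 0" "H \<noteq> 0" "G ** H = 0" "F = G + H"
      using less.prems unfolding prim_idem_def by blast
    have HG: "H ** G = 0" using BM_commute[OF GH(2,1)] GH(7) by simp
    have G_range: "G *v v = F *v (G *v v)" for v
      unfolding GH(8) matrix_vector_mult_add_rdistrib by (simp add: matrix_vector_mul_assoc GH HG)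
    have H_range: "H *v v = F *v (H *v v)" for v
      unfolding GH(8) matrix_vector_mult_add_rdistrib by (simp add: matrix_vector_mul_assoc GH)
    obtain v where v: "H *v v \<noteq> 0"
      using GH(6) by (metis matrix_eq matrix_vector_mult_0)
    have "H *v v \<notin> range (\<lambda>v. G *v v)"
    proof
      assume "H *v v \<in> range (\<lambda>v. G *v v)"
      then obtain u where u: "H *v v = G *v u" by blast
      have "G *v u = G *v (G *v u)" by (simp add: matrix_vector_mul_assoc GH(3))
      also have "\<dots> = G *v (H *v v)" by (simp only: u)
      also have "\<dots> = 0" by (simp add: matrix_vector_mul_assoc GH(7))
      finally have "G *v u = 0" .
      then show False using v u by simp
    qed
    moreover have "range (\<lambda>v. G *v v) \<subseteq> range (\<lambda>v. F *v v)" "H *v v \<in> range (\<lambda>v. F *v v)"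
      using G_range H_range by (blast intro: range_eqI)+
    ultimately have "range (\<lambda>v. G *v v) \<subset> range (\<lambda>v. F *v v)" by blast
    then have "dim (range (\<lambda>v. G *v v)) < dim (range (\<lambda>v. F *v v))"
      by (intro dim_psubset) (simp only: span_range_mv)
    from less.hyps[OF this GH(1,3,5)] obtain P where P: "prim_idem (BM adj) P" "P ** G = P"
      by blast
    have "G ** F = G" unfolding GH(8) by (simp add: matrix_add_ldistrib GH(3,7))
    then have "P ** F = P" using P(2) by (metis matrix_mul_assoc)
    then show ?thesis using P(1) by blast
  qed
qed

end

section \<open>Entrywise complex conjugation\<close>

definition cnjv :: "'v::finite cvec \<Rightarrow> 'v cvec" where
  "cnjv w = (\<chi> y. cnj (w$y))"

lemma cnjv_add: "cnjv (u + w) = cnjv u + cnjv w"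
  and cnjv_scale: "cnjv (c *s u) = cnj c *s cnjv u"
  and cnjv_0: "cnjv 0 = 0"
  by (simp_all add: cnjv_def vec_eq_iff)

lemma cnjv_sum: "cnjv (\<Sum>i\<in>I. w i) = (\<Sum>i\<in>I. cnjv (w i))"
  by (induction I rule: infinite_finite_induct) (auto simp: cnjv_add cnjv_0)

lemma mv_axis: "((M :: 'v::finite cmat) *v axis x 1)$y = M$y$x"
  by (simp add: matrix_vector_mult_def axis_def if_distrib cong: if_cong)

lemma cadj_Amat:
  assumes "simple_graph adj" shows "cadj (Amat adj) = Amat adj"
  using assms by (auto simp: cadj_def Amat_def vec_eq_iff simple_graph_def)

text \<open>\<open>qk i j h\<close> is the Krein parameter \<open>q\<^sup>h\<^sub>i\<^sub>j\<close>,
  and \<open>krein_0\<close> is its triangle condition.\<close>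

locale qpoly_drg = bipartite_drg adj for adj :: "'v::finite \<Rightarrow> 'v \<Rightarrow> bool" +
  fixes D :: nat and E :: "nat \<Rightarrow> 'v cmat" and q :: complex
    and qk :: "nat \<Rightarrow> nat \<Rightarrow> nat \<Rightarrow> complex"
  assumes D_diam: "D = diam adj" and D3: "3 \<le> D"
    and E_inj: "inj_on E {..D}" and E_image: "E ` {..D} = {P. prim_idem (BM adj) P}"
    and krein: "\<And>i j. i \<le> D \<Longrightarrow> j \<le> D \<Longrightarrow>
      hadamard (E i) (E j) = smat (1 / of_nat CARD('v)) (\<Sum>h\<le>D. smat (qk i j h) (E h))"
    and krein_0: "\<And>h i j. h \<le> D \<Longrightarrow> i \<le> D \<Longrightarrow> j \<le> D \<Longrightarrow>
      h > i + j \<or> i > h + j \<or> j > h + i \<Longrightarrow> qk i j h = 0"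
    and q_0: "q \<noteq> 0" and q_4: "q ^ 4 \<noteq> 1"
    and theta: "Amat adj = (\<Sum>i\<le>D. smat (thq q D i) (E i))"
begin

abbreviation "th \<equiv> thq q D"

section \<open>Spectral decomposition of the adjacency matrix\<close>

lemma E_prim: "i \<le> D \<Longrightarrow> prim_idem (BM adj) (E i)"
  using E_image by auto

lemma E_BM: "i \<le> D \<Longrightarrow> E i \<in> BM adj"
  and E_idem: "i \<le> D \<Longrightarrow> E i ** E i = E i"
  and E_nonzero: "i \<le> D \<Longrightarrow> E i \<noteq> 0"
  using E_prim by (auto simp: prim_idem_def)

text \<open>Otherwise \<open>P ** R\<close> and \<open>P - P ** R\<close> would split
  \<open>P\<close> into two nonzero orthogonal idempotents.\<close>

lemma prim_idem_absorb:
  assumes P: "prim_idem (BM adj) P" and R: "R \<in> BM adj" "R ** R = R"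
  shows "P ** R = 0 \<or> P ** R = P"
proof (rule ccontr)
  assume "\<not> ?thesis"
  then have ne: "P ** R \<noteq> 0" "P - P ** R \<noteq> 0" by auto
  have PB: "P \<in> BM adj" and PP: "P ** P = P"
    using P by (auto simp: prim_idem_def)
  have comm: "R ** P = P ** R" using BM_commute[OF R(1) PB] .
  have PPR: "P ** (P ** R) = P ** R"
    by (simp add: matrix_mul_assoc PP)
  have PRP: "(P ** R) ** P = P ** R"
    by (simp add: matrix_mul_assoc[symmetric] comm PPR)
  have PRPR: "(P ** R) ** (P ** R) = P ** R"
    by (simp add: matrix_mul_assoc PRP) (simp add: matrix_mul_assoc[symmetric] R(2))
  have "(P - P ** R) ** (P - P ** R) = P - P ** R"
    by (simp add: matrix_diff_ldistrib matrix_diff_rdistrib PP PPR PRP PRPR)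
  moreover have "(P ** R) ** (P - P ** R) = 0"
    by (simp add: matrix_diff_ldistrib PRP PRPR)
  moreover have "P = P ** R + (P - P ** R)" by simp
  moreover have "P ** R \<in> BM adj" "P - P ** R \<in> BM adj"
    using PB R by (auto intro: BM_mult BM_diff)
  ultimately show False
    using P ne PRPR unfolding prim_idem_def by blast
qed

lemma E_orth:
  assumes "i \<le> D" "j \<le> D" "i \<noteq> j"
  shows "E i ** E j = 0"
proof (rule ccontr)
  assume nz: "E i ** E j \<noteq> 0"
  then have "E i ** E j = E i"
    using prim_idem_absorb[OF E_prim E_BM E_idem] assms by blast
  moreover have "E j ** E i = E j"
    using prim_idem_absorb[OF E_prim E_BM E_idem, of j i] assms nz BM_commute[OF E_BM E_BM, of i j]
    by auto
  ultimately have "E i = E j"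
    using BM_commute[OF E_BM E_BM, of i j] assms by simp
  then show False using E_inj assms by (auto dest: inj_onD)
qed

lemma E_mult: "i \<le> D \<Longrightarrow> j \<le> D \<Longrightarrow> E i ** E j = (if i = j then E i else 0)"
  by (simp add: E_orth E_idem)

text \<open>The complementary idempotent \<open>F\<close> is killed by every \<open>E j\<close>;
  were it nonzero, some primitive \<open>E j\<close> would satisfy
  \<open>E j ** F = E j\<close>.\<close>

lemma sum_E: "(\<Sum>i\<le>D. E i) = mat 1"
proof -
  define F where "F = mat 1 - (\<Sum>i\<le>D. E i)"
  have EF: "E j ** F = 0" if "j \<le> D" for j
  proof -
    have "E j ** (\<Sum>i\<le>D. E i) = (\<Sum>i\<le>D. if i = j then E j else 0)"
      unfolding matrix_sum_ldistrib using that by (intro sum.cong) (auto simp: E_mult)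
    then show ?thesis using that by (simp add: F_def matrix_diff_ldistrib)
  qed
  have "(\<Sum>i\<le>D. E i) ** F = 0"
    unfolding matrix_sum_rdistrib using EF by simp
  then have FF: "F ** F = F"
    using matrix_diff_rdistrib[of "mat 1" "\<Sum>i\<le>D. E i" F] by (simp flip: F_def)
  have "F \<in> BM adj"
    unfolding F_def by (intro BM_diff BM_one BM_sum E_BM) auto
  have "F = 0"
  proof (rule ccontr)
    assume "F \<noteq> 0"
    then obtain P where P: "prim_idem (BM adj) P" "P ** F = P"
      using idempotent_above_primitive[OF \<open>F \<in> BM adj\<close> FF] by blast
    then obtain j where "j \<le> D" "P = E j"
      using E_image by (metis (mono_tags, lifting) atMost_iff imageE mem_Collect_eq)
    then show False using EF P E_nonzero by auto
  qed
  then show ?thesis by (simp add: F_def)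
qed

lemma E_mv: "i \<le> D \<Longrightarrow> j \<le> D \<Longrightarrow> E i *v (E j *v w) = (if i = j then E i *v w else 0)"
  by (simp add: matrix_vector_mul_assoc E_mult)

lemma sum_E_mv: "(\<Sum>i\<le>D. E i *v w) = w"
  by (simp flip: sum_mv add: sum_E)

lemma A_mv: "A *v w = (\<Sum>i\<le>D. th i *s (E i *v w))"
  by (subst theta) (simp add: sum_mv smat_mv)

lemma A_E_mv: 
  assumes "i \<le> D" shows "A *v (E i *v w) = th i *s (E i *v w)"
proof -
  have "A *v (E i *v w) = (\<Sum>j\<le>D. if j = i then th i *s (E i *v w) else 0)"
    unfolding A_mv using assms by (intro sum.cong) (auto simp: E_mv)
  then show ?thesis using assms by simp
qed

lemma E_A_mv: 
  assumes "i \<le> D" shows "E i *v (A *v w) = th i *s (E i *v w)"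
proof -
  have "E i *v (A *v w) = (\<Sum>j\<le>D. if j = i then th i *s (E i *v w) else 0)"
    unfolding A_mv mv_sum using assms by (intro sum.cong) (auto simp: E_mv mv_scale)
  then show ?thesis using assms by simp
qed

section \<open>Products of shifted adjacency matrices, and distinctness of the eigenvalues\<close>

text \<open>The product of the factors \<open>A - c\<close> applied to a vector: scalar on each
  eigenspace, yet with entries controlled by walks.\<close>

primrec shift_prod :: "complex list \<Rightarrow> 'v cvec \<Rightarrow> 'v cvec" where
  "shift_prod [] v = v"
| "shift_prod (c # cs) v = A *v shift_prod cs v - c *s shift_prod cs v"

lemma shift_prod_add: "shift_prod cs (u + v) = shift_prod cs u + shift_prod cs v"
  by (induction cs) (simp_all add: matrix_vector_right_distrib vector_add_ldistrib)

lemma shift_prod_0: "shift_prod cs 0 = 0"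
  by (induction cs) simp_all

lemma shift_prod_sum: "shift_prod cs (\<Sum>i\<in>I. w i) = (\<Sum>i\<in>I. shift_prod cs (w i))"
  by (induction I rule: infinite_finite_induct) (auto simp: shift_prod_add shift_prod_0)

lemma shift_prod_E:
  "i \<le> D \<Longrightarrow> shift_prod cs (E i *v w) = prod_list (map (\<lambda>c. th i - c) cs) *s (E i *v w)"
proof (induction cs)
  case (Cons c cs)
  then show ?case
    by (simp add: mv_scale A_E_mv) (simp add: vec_eq_iff algebra_simps)
qed simp

lemma A_mv_nth: "(A *v w)$y = (\<Sum>z | adj y z. w$z)"
proof -
  have "(A *v w)$y = (\<Sum>z\<in>UNIV. if adj y z then w$z else 0)"
    unfolding matrix_vector_mult_def Amat_def by (auto intro!: sum.cong)
  then show ?thesis by (simp add: sum.If_cases)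
qed

text \<open>At distance equal to the number of factors the shifts contribute nothing, so the entry
  counts geodesics; farther out no walk arrives.\<close>

lemma shift_prod_axis:
  "(dist\<^sub>G x y > length cs \<longrightarrow> shift_prod cs (axis x 1) $ y = 0) \<and>
   (dist\<^sub>G x y = length cs \<longrightarrow> (\<exists>r>0. shift_prod cs (axis x 1) $ y = of_real r))"
proof (induction cs arbitrary: y)
  case Nil
  show ?case
    by (auto simp: axis_def intro: exI[of _ 1])
next
  case (Cons c cs)
  let ?p = "shift_prod cs (axis x 1)"
  have far: "(\<Sum>z | adj y z. ?p$z) = 0" if "dist\<^sub>G x y > length (c # cs)"
    using gdist_adj[of y _ x] Cons that by (intro sum.neutral) force
  have near: "\<exists>r>0. (\<Sum>z | adj y z. ?p$z) = of_real r" if eq: "dist\<^sub>G x y = length (c # cs)"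
  proof -
    have "\<exists>r. (adj y z \<longrightarrow> ?p$z = of_real r) \<and> r \<ge> 0 \<and> (dist\<^sub>G x z = length cs \<longrightarrow> r > 0)" for z
    proof (cases "dist\<^sub>G x z = length cs")
      case True
      then show ?thesis using Cons[of z] by (auto intro: less_imp_le)
    next
      case False
      then have "adj y z \<Longrightarrow> dist\<^sub>G x z > length cs"
        using gdist_adj[of y z x] eq by auto
      then show ?thesis using Cons[of z] False by (intro exI[of _ 0]) auto
    qed
    then obtain r where r: "\<And>z. adj y z \<Longrightarrow> ?p$z = of_real (r z)" "\<And>z. r z \<ge> 0"
      "\<And>z. dist\<^sub>G x z = length cs \<Longrightarrow> r z > 0"
      by metis
    obtain z where z: "adj z y" "dist\<^sub>G x z = length cs"
      using gdist_SucE[of x y "length cs"] eq by auto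
    have "(\<Sum>z | adj y z. ?p$z) = of_real (\<Sum>z | adj y z. r z)"
      using r(1) by simp
    moreover have "0 < (\<Sum>z | adj y z. r z)"
      using z r(2,3) adj_sym by (intro sum_pos2[of _ z]) auto
    ultimately show ?thesis by blast
  qed
  show ?case
    using far near Cons[of y] by (auto simp: A_mv_nth)
qed

text \<open>With a repeated eigenvalue, a product of only \<open>D\<close> factors \<open>A - \<theta>\<^sub>l\<close> would vanish, although
  its entries at distance \<open>D\<close> count walks.\<close>

lemma th_inj:
  assumes ij: "i \<le> D" "j \<le> D" "th i = th j"
  shows "i = j"
proof (rule ccontr)
  assume "i \<noteq> j"
  obtain x y where xy: "dist\<^sub>G x y = D" 
    using ex_gdist_eq D_diam by blast
  define cs where "cs = map th (filter (\<lambda>l. l \<noteq> j) [0..<Suc D])"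
  have set_eq: "set (filter (\<lambda>l. l \<noteq> j) [0..<Suc D]) = {..D} - {j}" by auto
  then have "length (filter (\<lambda>l. l \<noteq> j) [0..<Suc D]) = card ({..D} - {j})"
    using distinct_card[of "filter (\<lambda>l. l \<noteq> j) [0..<Suc D]"] by simp
  then have len: "length cs = D"
    using ij by (simp add: cs_def)
  have "prod_list (map (\<lambda>c. th l - c) cs) = 0" if "l \<le> D" for l
  proof -
    have "set cs = th ` ({..D} - {j})"
      unfolding cs_def set_map set_eq ..
    then have "th l \<in> set cs"
      using that ij \<open>i \<noteq> j\<close> by (cases "l = j") (auto intro: image_eqI[of _ _ i])
    then show ?thesis by (auto simp: prod_list_zero_iff)
  qed
  then have "shift_prod cs (\<Sum>l\<le>D. E l *v axis x 1) = 0"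
    by (simp add: shift_prod_sum shift_prod_E)
  then have "shift_prod cs (axis x 1) $ y = 0"
    by (simp add: sum_E_mv)
  then show False
    using shift_prod_axis[where x = x and y = y and cs = cs] xy len by auto
qed

lemma eigenvector_E:
  assumes "A *v u = th j *s u" "i \<le> D" "j \<le> D"
  shows "E i *v u = (if i = j then u else 0)"
proof -
  have *: "E i *v u = 0" if "i \<le> D" "i \<noteq> j" for i
  proof -
    have "th i *s (E i *v u) = th j *s (E i *v u)"
      by (simp only: E_A_mv[OF that(1), symmetric] assms(1) mv_scale)
    then have "(th i - th j) *s (E i *v u) = 0"
      by (simp add: vector_sub_rdistrib)
    moreover have "th i \<noteq> th j" using th_inj that assms by blast
    ultimately show ?thesis by (metis vector_mul_eq_0 right_minus_eq)
  qed
  have "u = (\<Sum>i\<le>D. E i *v u)" by (simp add: sum_E_mv)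
  also have "\<dots> = (\<Sum>i\<le>D. if i = j then E j *v u else 0)"
    using * by (intro sum.cong) auto
  also have "\<dots> = E j *v u" using assms by simp
  finally show ?thesis using * assms by auto
qed

section \<open>Reality of the eigenvalues and the idempotents\<close>

lemma th_real:
  assumes i: "i \<le> D" shows "th i \<in> \<real>"
proof -
  obtain w where "E i *v w \<noteq> 0"
    using E_nonzero[OF i] by (metis matrix_eq matrix_vector_mult_0)
  define u where "u = E i *v w"
  have u: "A *v u = th i *s u" "u \<noteq> 0"
    using A_E_mv[OF i] \<open>E i *v w \<noteq> 0\<close> by (auto simp: u_def)
  \<comment> \<open>Pairing with \<open>\<i> *s u\<close> lets the real inner product see the
    imaginary part: self-adjointness leaves \<open>2 * Im (th i)\<close> times the squared norm of
    \<open>u\<close>.\<close>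
  have "(A *v u) \<bullet> (\<i> *s u) = u \<bullet> (A *v (\<i> *s u))"
    by (simp add: inner_cadj cadj_Amat simple)
  then have "u \<bullet> ((cnj (th i) * \<i>) *s u) = u \<bullet> ((\<i> * th i) *s u)"
    by (simp add: u mv_scale inner_cscale)
  then have "u \<bullet> ((cnj (th i) * \<i>) *s u - (\<i> * th i) *s u) = 0"
    by (simp add: inner_diff_right)
  also have "(cnj (th i) * \<i>) *s u - (\<i> * th i) *s u = (2 * Im (th i)) *\<^sub>R u"
    unfolding scaleR_cvec by (simp add: vec_eq_iff complex_eq_iff algebra_simps)
  finally show ?thesis using u(2) by (simp add: complex_is_Real_iff)
qed

lemma A_cnjv: "A *v cnjv w = cnjv (A *v w)"
  by (simp add: vec_eq_iff A_mv_nth cnjv_def)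

text \<open>Conjugation preserves each eigenspace, as \<open>A\<close> and its eigenvalues are real,
  and so commutes with \<open>E i\<close>.\<close>

lemma E_real:
  assumes i: "i \<le> D" shows "cnj (E i$y$z) = E i$y$z"
proof -
  have *: "E i *v cnjv (E j *v w) = (if i = j then cnjv (E j *v w) else 0)" if "j \<le> D" for j w
    using that i th_real[OF that]
    by (intro eigenvector_E) (simp_all add: A_cnjv A_E_mv cnjv_scale Reals_cnj_iff)
  have "E i *v cnjv w = cnjv (E i *v w)" for w
  proof -
    have "E i *v cnjv w = (\<Sum>j\<le>D. E i *v cnjv (E j *v w))"
      by (simp flip: mv_sum cnjv_sum add: sum_E_mv)
    also have "\<dots> = (\<Sum>j\<le>D. if i = j then cnjv (E j *v w) else 0)"
      using * by (intro sum.cong) auto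
    finally show ?thesis using i by simp
  qed
  from this[of "axis z 1"] have "(E i *v axis z 1)$y = cnj ((E i *v axis z 1)$y)"
    by (simp add: cnjv_def axis_def vec_eq_iff if_distrib cong: if_cong)
  then show ?thesis by (simp add: mv_axis)
qed

section \<open>Triple products and Krein parameters\<close>

lemma E_sym: "i \<le> D \<Longrightarrow> E i$y$z = E i$z$y"
  by (rule BM_sym[OF E_BM])

lemma E_nth_mult: "i \<le> D \<Longrightarrow> (\<Sum>w\<in>UNIV. E i$w$y * E i$w$z) = E i$y$z"
proof -
  assume i: "i \<le> D"
  have "(\<Sum>w\<in>UNIV. E i$w$y * E i$w$z) = (E i ** E i)$y$z"
    by (simp add: matrix_matrix_mult_def E_sym[OF i, of _ y])
  then show ?thesis by (simp add: E_idem[OF i])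
qed

lemma hadamard_mult_E:
  assumes "i \<le> D" "j \<le> D" "h \<le> D"
  shows "hadamard (E i) (E j) ** E h = smat (qk i j h / of_nat CARD('v)) (E h)"
proof -
  have "(\<Sum>l\<le>D. smat (qk i j l) (E l)) ** E h = (\<Sum>l\<le>D. if l = h then smat (qk i j h) (E h) else 0)"
    unfolding matrix_sum_rdistrib using assms
    by (intro sum.cong) (auto simp: smat_mult_left E_mult, simp add: smat_def vec_eq_iff)
  then show ?thesis
    using assms by (simp add: krein smat_mult_left) (simp add: smat_def vec_eq_iff)
qed

lemma sum_swap_5:
  "(\<Sum>x\<in>X. \<Sum>y\<in>Y. \<Sum>z\<in>Z. \<Sum>w\<in>W. \<Sum>w'\<in>W'. g x y z w w')
    = (\<Sum>w\<in>W. \<Sum>w'\<in>W'. \<Sum>x\<in>X. \<Sum>y\<in>Y. \<Sum>z\<in>Z. g x y z w w')"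
  unfolding sum.cartesian_product
  by (rule sum.reindex_bij_witness[of _ "\<lambda>(w,w',x,y,z). (x,y,z,w,w')" "\<lambda>(x,y,z,w,w'). (w,w',x,y,z)"])
    auto

lemma sum_product_3:
  "(\<Sum>x\<in>X. f x) * ((\<Sum>y\<in>Y. g y) * (\<Sum>z\<in>Z. h z))
    = (\<Sum>x\<in>X. \<Sum>y\<in>Y. \<Sum>z\<in>Z. f x * (g y * h z) :: complex)"
proof -
  have "(\<Sum>x\<in>X. f x) * ((\<Sum>y\<in>Y. g y) * (\<Sum>z\<in>Z. h z))
      = (\<Sum>x\<in>X. f x) * (\<Sum>y\<in>Y. \<Sum>z\<in>Z. g y * h z)"
    by (simp only: sum_product)
  also have "\<dots> = (\<Sum>x\<in>X. \<Sum>y\<in>Y. f x * (\<Sum>z\<in>Z. g y * h z))"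
    by (rule sum_product)
  finally show ?thesis by (simp only: sum_distrib_left)
qed

text \<open>The squared Frobenius norms of \<open>E\<^sub>iA\<^sup>*E\<^sub>j\<close>, summed over all base vertices, give
  \<open>|X| q\<^sup>j\<^sub>1\<^sub>i tr E\<^sub>j\<close>.\<close>

lemma triple_product_0:
  assumes i: "i \<le> D" and j: "j \<le> D" and qk0: "qk 1 i j = 0"
  shows "E i ** Astar E x ** E j = 0"
proof -
  let ?n = "of_nat CARD('v) :: complex"
  define M where "M x = E i ** Astar E x ** E j" for x
  have 1: "1 \<le> D" using D3 by simp
  have M: "M x$y$z = ?n * (\<Sum>w\<in>UNIV. E 1$x$w * E i$y$w * E j$z$w)" for x y z
    unfolding M_def matrix_matrix_mult_def Astar_def
    using E_sym[OF j] by (simp add: if_distrib sum_distrib_left algebra_simps cong: if_cong)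
  have real: "cnj (M x$y$z) = M x$y$z" for x y z
    unfolding M using E_real i j 1 by simp
  have "(\<Sum>x\<in>UNIV. \<Sum>y\<in>UNIV. \<Sum>z\<in>UNIV. M x$y$z * M x$y$z)
     = ?n * ?n * (\<Sum>x\<in>UNIV. \<Sum>y\<in>UNIV. \<Sum>z\<in>UNIV. \<Sum>w\<in>UNIV. \<Sum>w'\<in>UNIV.
         (E 1$x$w * E i$y$w * E j$z$w) * (E 1$x$w' * E i$y$w' * E j$z$w'))"
    unfolding M by (simp add: sum_distrib_left sum_product algebra_simps)
  also have "\<dots> = ?n * ?n * (\<Sum>w\<in>UNIV. \<Sum>w'\<in>UNIV. \<Sum>x\<in>UNIV. \<Sum>y\<in>UNIV. \<Sum>z\<in>UNIV.
         (E 1$x$w * E i$y$w * E j$z$w) * (E 1$x$w' * E i$y$w' * E j$z$w'))"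
    by (subst sum_swap_5) (rule refl)
  also have "\<dots> = ?n * ?n * (\<Sum>w\<in>UNIV. \<Sum>w'\<in>UNIV. (\<Sum>x\<in>UNIV. E 1$x$w * E 1$x$w') *
         ((\<Sum>y\<in>UNIV. E i$y$w * E i$y$w') * (\<Sum>z\<in>UNIV. E j$z$w * E j$z$w')))"
    unfolding sum_product_3 by (simp add: mult_ac)
  also have "\<dots> = ?n * ?n * (\<Sum>w\<in>UNIV. \<Sum>w'\<in>UNIV. E 1$w$w' * (E i$w$w' * E j$w'$w))"
    by (simp only: E_nth_mult[OF 1] E_nth_mult[OF i] E_nth_mult[OF j]) (simp only: E_sym[OF j])
  also have "\<dots> = ?n * ?n * (\<Sum>w\<in>UNIV. (hadamard (E 1) (E i) ** E j)$w$w)"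
    by (simp add: hadamard_def matrix_matrix_mult_def mult.assoc)
  also have "\<dots> = 0"
    using hadamard_mult_E[OF 1 i j] qk0 by (simp add: smat_def)
  finally have "(\<Sum>x\<in>UNIV. \<Sum>y\<in>UNIV. \<Sum>z\<in>UNIV. M x$y$z * cnj (M x$y$z)) = 0"
    by (simp add: real)
  then have "complex_of_real (\<Sum>x\<in>UNIV. \<Sum>y\<in>UNIV. \<Sum>z\<in>UNIV. (cmod (M x$y$z))\<^sup>2) = 0"
    by (simp only: of_real_sum complex_norm_square)
  then have "(\<Sum>x\<in>UNIV. \<Sum>y\<in>UNIV. \<Sum>z\<in>UNIV. (cmod (M x$y$z))\<^sup>2) = 0"
    using of_real_eq_0_iff by blast
  then have "M x$y$z = 0" for y z
    by (simp add: sum_nonneg_eq_0_iff sum_nonneg)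
  then show ?thesis by (simp add: M_def vec_eq_iff)
qed

lemma Astar_mv_nth: "(Astar E x *v w)$y = of_nat CARD('v) * E 1$x$y * w$y"
proof -
  have "(Astar E x *v w)$y
      = (\<Sum>z\<in>UNIV. (if y = z then of_nat CARD('v) * E 1$x$y else 0) * w$z)"
    by (simp add: matrix_vector_mult_def Astar_def)
  also have "\<dots> = (\<Sum>z\<in>UNIV. if z = y then of_nat CARD('v) * E 1$x$y * w$y else 0)"
    by (rule sum.cong) auto
  finally show ?thesis by simp
qed

text \<open>\<open>Astar E x\<close> turns column \<open>x\<close> of \<open>E i\<close> into
  \<open>|X|\<close> times column \<open>x\<close> of the entrywise product with \<open>E 1\<close>,
  a matrix of the Bose-Mesner algebra. One vector thus reveals \<open>qk 1 i i\<close>.\<close>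

lemma triple_product_axis:
  assumes i: "i \<le> D"
  shows "E i *v (Astar E x *v (E i *v axis x 1)) = qk 1 i i *s (E i *v axis x 1)"
proof -
  let ?n = "of_nat CARD('v) :: complex"
  have 1: "1 \<le> D" using D3 by simp
  have "Astar E x *v (E i *v axis x 1) = ?n *s (hadamard (E 1) (E i) *v axis x 1)"
    by (simp add: vec_eq_iff mv_axis hadamard_def Astar_mv_nth E_sym[OF 1, of x]
        del: One_nat_def)
  then have "E i *v (Astar E x *v (E i *v axis x 1))
     = ?n *s ((E i ** hadamard (E 1) (E i)) *v axis x 1)"
    by (simp only: mv_scale mv_assoc)
  also have "hadamard (E 1) (E i) \<in> BM adj"
    using E_BM 1 i by (intro BM_hadamard)
  then have "E i ** hadamard (E 1) (E i) = smat (qk 1 i i / ?n) (E i)"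
    by (simp only: BM_commute[OF E_BM[OF i]] hadamard_mult_E[OF 1 i i])
  also have "?n *s (smat (qk 1 i i / ?n) (E i) *v axis x 1) = qk 1 i i *s (E i *v axis x 1)"
    by (simp add: smat_mv)
  finally show ?thesis .
qed

end

section \<open>The subconstituent algebra\<close>

text \<open>Lagrange interpolation: up to a nonzero scalar, \<open>F i\<close> is the product of
  \<open>M - \<theta> j\<close> over \<open>j \<noteq> i\<close>.\<close>

lemma Talg_spectral_idempotent:
  fixes D :: nat
  assumes M: "M \<in> Talg A As"
    and F: "\<And>i. i \<le> D \<Longrightarrow> F i ** M = smat (\<theta> i) (F i)" "(\<Sum>i\<le>D. F i) = mat 1"
    and inj: "inj_on \<theta> {..D}" and i: "i \<le> D"
  shows "F i \<in> Talg A As"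
proof -
  \<comment> \<open>The spectral form of the product over \<open>J\<close>, built up one factor
    \<open>M - \<theta> j\<close> at a time.\<close>
  have *: "(\<Sum>i\<le>D. smat (\<Prod>j\<in>J. \<theta> i - \<theta> j) (F i)) \<in> Talg A As" if "finite J" for J
    using that
  proof (induction J)
    case empty
    have "smat 1 (F i) = F i" for i by (simp add: smat_def)
    then show ?case using F by (simp add: Talg.one)
  next
    case (insert j J)
    let ?S = "\<Sum>i\<le>D. smat (\<Prod>j\<in>J. \<theta> i - \<theta> j) (F i)"
    have "?S ** M + smat (- \<theta> j) ?S \<in> Talg A As"
      using insert.IH M by (intro Talg.add Talg.mult Talg.scale)
    also have "?S ** M = (\<Sum>i\<le>D. smat (\<Prod>j\<in>J. \<theta> i - \<theta> j) (smat (\<theta> i) (F i)))"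
      unfolding matrix_sum_rdistrib by (intro sum.cong refl) (simp add: smat_mult_left F)
    also have "smat (- \<theta> j) ?S = (\<Sum>i\<le>D. smat (- \<theta> j) (smat (\<Prod>j\<in>J. \<theta> i - \<theta> j) (F i)))"
      by (simp add: smat_def vec_eq_iff sum_distrib_left)
    also have "(\<Sum>i\<le>D. smat (\<Prod>j\<in>J. \<theta> i - \<theta> j) (smat (\<theta> i) (F i))) + \<dots>
        = (\<Sum>i\<le>D. smat (\<Prod>j\<in>insert j J. \<theta> i - \<theta> j) (F i))"
      unfolding sum.distrib[symmetric] using insert.hyps
      by (intro sum.cong refl) (simp add: smat_def vec_eq_iff algebra_simps)
    finally show ?case .
  qed
  let ?c = "\<lambda>l. \<Prod>j\<in>{..D} - {i}. \<theta> l - \<theta> j"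
  have "?c l = 0" if "l \<le> D" "l \<noteq> i" for l
    using that by (intro prod_zero) auto
  then have "(\<Sum>l\<le>D. smat (?c l) (F l)) = (\<Sum>l\<le>D. if l = i then smat (?c i) (F i) else 0)"
    by (intro sum.cong) (auto simp: smat_def vec_eq_iff)
  then have "smat (?c i) (F i) \<in> Talg A As"
    using *[of "{..D} - {i}"] i by simp
  then have "smat (inverse (?c i)) (smat (?c i) (F i)) \<in> Talg A As"
    by (rule Talg.scale)
  moreover have "?c i \<noteq> 0"
    using inj i by (auto dest: inj_onD)
  then have "smat (inverse (?c i)) (smat (?c i) (F i)) = F i"
    by (simp add: smat_def vec_eq_iff)
  ultimately show ?thesis by simp
qed

locale terwilliger_algebra = qpoly_drg adj D E q qk
  for adj :: "'v::finite \<Rightarrow> 'v \<Rightarrow> bool" and D :: nat and E q qk +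
  fixes x :: 'v
  assumes theta_star: "Astar E x = (\<Sum>i\<le>D. smat (thq q D i) (Estar adj x i))"
begin

abbreviation "As \<equiv> Astar E x"
abbreviation "Es \<equiv> Estar adj x"
abbreviation "T \<equiv> Talg A As"
abbreviation "v \<equiv> vpar q D"

lemma dist_le_D: "dist\<^sub>G y z \<le> D"
  using gdist_le_diam D_diam by simp

lemma Es_nth: "(Es i *v w)$y = (if dist\<^sub>G x y = i then w$y else 0)"
proof -
  have "(Es i *v w)$y = (\<Sum>z\<in>UNIV. (if y = z \<and> dist\<^sub>G x y = i then 1 else 0) * w$z)"
    by (simp add: matrix_vector_mult_def Estar_def)
  also have "\<dots> = (\<Sum>z\<in>UNIV. if z = y then (if dist\<^sub>G x y = i then w$y else 0) else 0)"
    by (rule sum.cong) auto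
  finally show ?thesis by simp
qed

lemma As_nth: "(As *v w)$y = th (dist\<^sub>G x y) * w$y"
proof -
  have "(As *v w)$y = (\<Sum>i\<le>D. th i * (if dist\<^sub>G x y = i then w$y else 0))"
    by (simp add: theta_star sum_mv smat_mv Es_nth)
  also have "\<dots> = (\<Sum>i\<le>D. if i = dist\<^sub>G x y then th i * w$y else 0)"
    by (rule sum.cong) auto
  finally show ?thesis using dist_le_D by simp
qed

lemma Es_in_T: "i \<le> D \<Longrightarrow> Es i \<in> T"
proof (rule Talg_spectral_idempotent[where \<theta> = th and D = D and M = As])
  show "Es i ** As = smat (th i) (Es i)" for i
    by (simp add: matrix_eq mv_assoc smat_mv vec_eq_iff Es_nth As_nth)
  show "(\<Sum>i\<le>D. Es i) = mat 1"
    using dist_le_D by (simp add: matrix_eq sum_mv vec_eq_iff Es_nth)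
qed (auto intro: Talg.gAs inj_onI th_inj)

lemma E_in_T: "i \<le> D \<Longrightarrow> E i \<in> T"
proof (rule Talg_spectral_idempotent[where \<theta> = th and D = D and M = A])
  show "E i ** A = smat (th i) (E i)" if "i \<le> D" for i
    by (simp add: matrix_eq mv_assoc smat_mv E_A_mv that)
qed (auto intro: Talg.gA inj_onI th_inj sum_E)

text \<open>Both generators are self-adjoint, \<open>As\<close> because its diagonal entries are
  among the real numbers \<open>th i\<close>.\<close>

sublocale selfadjoint_matrices T
proof
  have cnj_th: "cnj (th (dist\<^sub>G x y)) = th (dist\<^sub>G x y)" for y
    using th_real[OF dist_le_D] Reals_cnj_iff by blast
  have As_nth_nth: "As$y$z = (if y = z then th (dist\<^sub>G x y) else 0)" for y z
    using As_nth[of "axis z 1" y] by (simp add: mv_axis) (simp add: axis_def)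
  fix M assume "M \<in> T"
  then show "cadj M \<in> T"
  proof induction
    case one
    have "cadj (mat 1) = (mat 1 :: 'v cmat)" by (simp add: cadj_def mat_def vec_eq_iff)
    then show ?case by (simp add: Talg.one)
  next
    case gA
    then show ?case by (simp add: cadj_Amat simple Talg.gA)
  next
    case gAs
    have "cadj As = As" by (simp add: cadj_def vec_eq_iff As_nth_nth cnj_th)
    then show ?case by (simp add: Talg.gAs)
  next
    case (add M N)
    have "cadj (M + N) = cadj M + cadj N" by (simp add: cadj_def vec_eq_iff)
    then show ?case using add.IH by (simp add: Talg.add)
  next
    case (scale M c)
    have "cadj (smat c M) = smat (cnj c) (cadj M)" by (simp add: cadj_def smat_def vec_eq_iff)
    then show ?case using scale.IH by (simp add: Talg.scale)
  next
    case (mult M N)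
    have "cadj (M ** N) = cadj N ** cadj M"
      by (simp add: cadj_def matrix_matrix_mult_def vec_eq_iff mult.commute)
    then show ?case using mult.IH by (simp add: Talg.mult)
  qed
qed

section \<open>The eigenvalues\<close>

text \<open>The scalar by which \<open>A\<^sup>2A\<^sup>* - (q\<^sup>2 + q\<^sup>-\<^sup>2)AA\<^sup>*A + A\<^sup>*A\<^sup>2\<close> acts relative to \<open>A\<^sup>*\<close> between \<open>E\<^sub>jV\<close> and \<open>E\<^sub>iV\<close>.\<close>

definition "aw i j = (th i)\<^sup>2 + (th j)\<^sup>2 - (q\<^sup>2 + inverse (q\<^sup>2)) * (th i * th j)"
definition "Q = (v * (q\<^sup>2 - inverse (q\<^sup>2)))\<^sup>2"

lemma powi_minus_2: "q powi (- 2) = inverse (q\<^sup>2)"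
  by (simp add: power_int_def power_inverse)

lemma th_eq: "th i = v * (q powi (int D - 2 * int i) - inverse (q powi (int D - 2 * int i)))"
  using power_int_minus[of q "int D - 2 * int i"] by (simp add: thq_def)

lemma th_Suc_eq:
  "th (Suc i) = v * (q powi (int D - 2 * int i) * inverse (q\<^sup>2) - inverse (q powi (int D - 2 * int i)) * q\<^sup>2)"
proof -
  have "q powi (int D - 2 * int (Suc i)) = q powi (int D - 2 * int i) * inverse (q\<^sup>2)"
    using power_int_diff[of q "int D - 2 * int i" 2] q_0
    by (simp add: divide_inverse algebra_simps)
  then show ?thesis by (simp add: th_eq)
qed

lemma th_reflect:
  assumes "i \<le> D" shows "th (D - i) = - th i"
proof -
  have "int D - 2 * int (D - i) = - (int D - 2 * int i)" using assms by simp
  then show ?thesis unfolding th_eq by (simp only: power_int_minus) (simp add: algebra_simps)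
qed

lemma th_eq_0: "i \<le> D \<Longrightarrow> th i = 0 \<Longrightarrow> D = 2 * i"
  using th_reflect[of i] th_inj[of i "D - i"] by simp

lemma v_nonzero: "v \<noteq> 0"
  using th_inj[of 0 1] D3 by (auto simp: thq_def)

lemma q_diff_nonzero: "q\<^sup>2 - inverse (q\<^sup>2) \<noteq> 0" "q - inverse q \<noteq> 0" "q + inverse q \<noteq> 0"
proof -
  show 1: "q\<^sup>2 - inverse (q\<^sup>2) \<noteq> 0"
  proof
    assume "q\<^sup>2 - inverse (q\<^sup>2) = 0"
    then have "q\<^sup>2 * q\<^sup>2 = q\<^sup>2 * inverse (q\<^sup>2)" by simp
    then show False using q_0 q_4 by (simp flip: power_add)
  qed
  have "q\<^sup>2 - inverse (q\<^sup>2) = (q - inverse q) * (q + inverse q)"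
    by (simp add: algebra_simps power2_eq_square)
  then show "q - inverse q \<noteq> 0" "q + inverse q \<noteq> 0" using 1 by auto
qed

text \<open>One index step multiplies \<open>t = q^(D-2i)\<close> by \<open>q^(-2)\<close>; the
  claim becomes a polynomial identity modulo \<open>t * u = 1\<close> and
  \<open>p * r = 1\<close>.\<close>

lemma aw_Suc: "aw i (Suc i) = Q"
proof -
  define t u p r where "t = q powi (int D - 2 * int i)" and "u = inverse t"
    and "p = q\<^sup>2" and "r = inverse p"
  have *: "t * u = 1" "p * r = 1"
    using q_0 by (auto simp: t_def u_def p_def r_def)
  have "th i = v * (t - u)" "th (Suc i) = v * (t * r - u * p)"
    unfolding th_eq[of i] th_Suc_eq by (simp_all add: t_def u_def p_def r_def)
  moreover have "(v * (t - u))\<^sup>2 + (v * (t * r - u * p))\<^sup>2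
      - (p + r) * (v * (t - u) * (v * (t * r - u * p))) = (v * (p - r))\<^sup>2"
    using * by algebra
  ultimately show ?thesis
    unfolding aw_def Q_def by (simp only: p_def[symmetric] r_def[symmetric])
qed

lemma aw_commute: "aw i j = aw j i"
  by (simp add: aw_def algebra_simps)

text \<open>For a fixed interior index, \<open>aw - Q\<close> is a monic quadratic in the other
  eigenvalue whose roots are the two neighbouring eigenvalues; here it is evaluated on the
  diagonal.\<close>

lemma aw_diag: "aw (Suc i) (Suc i) - Q = (th (Suc i) - th (Suc (Suc i))) * (th (Suc i) - th i)"
proof -
  define t u p r where "t = q powi (int D - 2 * int (Suc i))" and "u = inverse t"
    and "p = q\<^sup>2" and "r = inverse p"
  have *: "t * u = 1" "p * r = 1"
    using q_0 by (auto simp: t_def u_def p_def r_def)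
  have "q powi (int D - 2 * int i) = t * p"
    using power_int_add[of q "int D - 2 * int (Suc i)" 2] q_0
    by (simp add: t_def p_def algebra_simps)
  then have "th i = v * (t * p - inverse (t * p))" by (simp add: th_eq)
  then have th_i: "th i = v * (t * p - u * r)"
    by (simp add: u_def r_def)
  have th: "th (Suc i) = v * (t - u)" "th (Suc (Suc i)) = v * (t * r - u * p)"
    by (simp_all only: th_eq[of "Suc i"] th_Suc_eq[of "Suc i"] t_def u_def p_def r_def)
  have "(v * (t - u))\<^sup>2 + (v * (t - u))\<^sup>2 - (p + r) * (v * (t - u) * (v * (t - u)))
      - (v * (p - r))\<^sup>2
      = (v * (t - u) - v * (t * r - u * p)) * (v * (t - u) - v * (t * p - u * r))"
    using * by algebra
  then show ?thesis
    unfolding aw_def Q_def th th_i by (simp only: p_def[symmetric] r_def[symmetric])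
qed

lemma aw_diag_neq:
  assumes "0 < i" "i < D" shows "aw i i \<noteq> Q"
proof -
  obtain l where l: "i = Suc l" using assms by (cases i) auto
  have "th (Suc l) \<noteq> th (Suc (Suc l))" "th (Suc l) \<noteq> th l"
    using th_inj[of "Suc l" "Suc (Suc l)"] th_inj[of "Suc l" l] assms l by auto
  then show ?thesis using aw_diag[of l] l by auto
qed

section \<open>The Askey-Wilson type relations\<close>

text \<open>On the entry of an edge \<open>y z\<close> the left side multiplies by \<open>aw\<close>
  at the distances of \<open>y\<close> and \<open>z\<close> from \<open>x\<close>. Bipartiteness
  makes these consecutive, where \<open>aw\<close> equals \<open>Q\<close>.\<close>

lemma relation_A:
  "As *v (As *v (A *v w)) + A *v (As *v (As *v w))
     - (q\<^sup>2 + inverse (q\<^sup>2)) *s (As *v (A *v (As *v w))) = Q *s (A *v w)"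
proof -
  define \<beta> where "\<beta> = q\<^sup>2 + inverse (q\<^sup>2)"
  let ?t = "\<lambda>y. th (dist\<^sub>G x y)"
  have "(\<Sum>z | adj y z. ?t y * (?t y * w$z) + ?t z * (?t z * w$z) - \<beta> * (?t y * (?t z * w$z)))
      = (\<Sum>z | adj y z. Q * w$z)" for y
  proof (intro sum.cong refl)
    fix z assume "z \<in> {z. adj y z}"
    then have "aw (dist\<^sub>G x y) (dist\<^sub>G x z) = Q"
      using gdist_adj[of y z x] aw_Suc aw_commute by auto
    then have "Q * w$z = ((?t y)\<^sup>2 + (?t z)\<^sup>2 - \<beta> * (?t y * ?t z)) * w$z"
      by (simp only: aw_def \<beta>_def)
    then show "?t y * (?t y * w$z) + ?t z * (?t z * w$z) - \<beta> * (?t y * (?t z * w$z)) = Q * w$z"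
      by (simp add: power2_eq_square algebra_simps)
  qed
  then show ?thesis
    unfolding \<beta>_def[symmetric]
    by (simp add: vec_eq_iff As_nth A_mv_nth sum.distrib sum_subtractf sum_distrib_left)
qed

text \<open>Dual to \<open>relation_A\<close>, with blocks between eigenspaces in place of entries;
  \<open>tri\<close> plays the part of bipartiteness.\<close>

lemma relation_As:
  assumes tri: "\<And>i j w. i \<le> D \<Longrightarrow> j \<le> D \<Longrightarrow> j \<noteq> Suc i \<Longrightarrow> i \<noteq> Suc j \<Longrightarrow> E i *v (As *v (E j *v w)) = 0"
  shows "A *v (A *v (As *v w)) + As *v (A *v (A *v w))
     - (q\<^sup>2 + inverse (q\<^sup>2)) *s (A *v (As *v (A *v w))) = Q *s (As *v w)"
    (is "?L w = ?R w")
proof -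
  have EE: "E i *v ?L (E j *v w) = E i *v ?R (E j *v w)" if ij: "i \<le> D" "j \<le> D" for i j
  proof -
    let ?e = "E i *v (As *v (E j *v w))"
    have "E i *v ?L (E j *v w) = aw i j *s ?e"
      unfolding matrix_vector_mult_diff_distrib matrix_vector_right_distrib
      using ij by (simp add: E_A_mv A_E_mv mv_scale)
        (simp add: vec_eq_iff aw_def algebra_simps power2_eq_square)
    also have "\<dots> = Q *s ?e"
    proof (cases "j = Suc i \<or> i = Suc j")
      case True
      then show ?thesis using aw_Suc aw_commute by auto
    qed (simp add: tri ij)
    finally show ?thesis by (simp add: mv_scale)
  qed
  have "?L (E j *v w) = ?R (E j *v w)" if "j \<le> D" for j
  proof -
    have "?L (E j *v w) = (\<Sum>i\<le>D. E i *v ?L (E j *v w))" by (rule sum_E_mv[symmetric])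
    also have "\<dots> = (\<Sum>i\<le>D. E i *v ?R (E j *v w))"
      using EE that by (intro sum.cong) auto
    finally show ?thesis by (simp add: sum_E_mv)
  qed
  then have "(\<Sum>j\<le>D. ?L (E j *v w)) = (\<Sum>j\<le>D. ?R (E j *v w))"
    by (intro sum.cong) auto
  moreover have "(\<Sum>j\<le>D. ?L (E j *v w)) = ?L (\<Sum>j\<le>D. E j *v w)"
    by (simp add: mv_sum sum.distrib sum_subtractf vec.scale_sum_right)
  moreover have "(\<Sum>j\<le>D. ?R (E j *v w)) = ?R (\<Sum>j\<le>D. E j *v w)"
    by (simp add: mv_sum vec.scale_sum_right)
  ultimately show ?thesis by (simp add: sum_E_mv)
qed

section \<open>Reflection of the spectrum by the bipartition\<close>

text \<open>The diagonal sign matrix of the bipartition, which commutes with \<open>As\<close> and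
  anticommutes with \<open>A\<close>.\<close>

definition sgv :: "'v cvec \<Rightarrow> 'v cvec" where
  "sgv w = (\<chi> y. (-1) ^ dist\<^sub>G x y * w$y)"

lemma sgv_add: "sgv (u + w) = sgv u + sgv w"
  and sgv_0: "sgv 0 = 0"
  and sgv_scale: "sgv (c *s w) = c *s sgv w"
  by (simp_all add: sgv_def vec_eq_iff algebra_simps)

lemma sgv_sgv: "sgv (sgv w) = w"
  by (simp add: sgv_def vec_eq_iff mult.assoc[symmetric] power_mult_distrib[symmetric])

lemma sgv_sum: "sgv (\<Sum>i\<in>I. w i) = (\<Sum>i\<in>I. sgv (w i))"
  by (induction I rule: infinite_finite_induct) (auto simp: sgv_add sgv_0)

lemma A_sgv: "A *v sgv w = - sgv (A *v w)"
proof -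
  have "(\<Sum>z | adj y z. (-1) ^ dist\<^sub>G x z * w$z) = (\<Sum>z | adj y z. - ((-1) ^ dist\<^sub>G x y * w$z))" for y
  proof (intro sum.cong refl)
    fix z assume "z \<in> {z. adj y z}"
    then show "(-1) ^ dist\<^sub>G x z * w$z = - ((-1) ^ dist\<^sub>G x y * w$z)"
      using gdist_adj[of y z x] by auto
  qed
  then show ?thesis
    by (simp add: sgv_def vec_eq_iff A_mv_nth sum_negf sum_distrib_left)
qed

lemma As_sgv: "As *v sgv w = sgv (As *v w)"
  by (simp add: vec_eq_iff As_nth sgv_def)

text \<open>Anticommuting with \<open>A\<close>, the sign change maps the eigenspace of
  \<open>th i\<close> to that of \<open>- th i = th (D - i)\<close>.\<close>

lemma E_sgv:
  assumes i: "i \<le> D" shows "E (D - i) *v sgv w = sgv (E i *v w)"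
proof -
  have *: "E (D - i) *v sgv (E j *v w) = (if j = i then sgv (E i *v w) else 0)" if j: "j \<le> D" for j
  proof -
    have "A *v sgv (E j *v w) = th (D - j) *s sgv (E j *v w)"
      by (simp add: A_sgv A_E_mv j sgv_scale th_reflect)
    from eigenvector_E[OF this, of "D - i"] show ?thesis
      using i j by auto
  qed
  have "E (D - i) *v sgv w = (\<Sum>j\<le>D. E (D - i) *v sgv (E j *v w))"
    by (simp flip: mv_sum sgv_sum add: sum_E_mv)
  also have "\<dots> = (\<Sum>j\<le>D. if j = i then sgv (E i *v w) else 0)"
    using * by (intro sum.cong) auto
  finally show ?thesis using i by simp
qed

lemma E_axis_nonzero: "i \<le> D \<Longrightarrow> E i *v axis x 1 \<noteq> 0"
  using BM_column_eq_0[OF E_BM, of i x] E_nonzero[of i] mv_axis[of "E i" x]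
  by (metis zero_index)

text \<open>The triangle condition covers indices at least two apart and \<open>i = j = 0\<close>;
  the sign reflection carries index \<open>0\<close> to \<open>D\<close>. At an interior
  \<open>i = j\<close>, \<open>diag\<close> on the single vector \<open>axis x 1\<close> forces
  \<open>qk 1 i i = 0\<close>.\<close>

lemma triple_product_tridiagonal:
  assumes diag: "\<And>i. 0 < i \<Longrightarrow> i < D \<Longrightarrow> E i *v (As *v (E i *v axis x 1)) = 0"
    and ij: "i \<le> D" "j \<le> D" "j \<noteq> Suc i" "i \<noteq> Suc j"
  shows "E i *v (As *v (E j *v w)) = 0"
proof -
  have 1: "1 \<le> D" using D3 by simp
  have vanish: "E i *v (As *v (E j *v w)) = 0" if "qk 1 i j = 0" "i \<le> D" "j \<le> D" for i j w
    using triple_product_0[OF that(2,3,1), of x] 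
    by (simp add: mv_assoc[symmetric] matrix_mul_assoc)
  have zero: "E 0 *v (As *v (E 0 *v w)) = 0" for w
    using vanish[of 0 0] krein_0[of 0 1 0] 1 by simp
  consider "i \<noteq> j" | "i = j" "i = 0" | "i = j" "0 < i" "i < D" | "i = j" "i = D"
    using ij by linarith
  then show ?thesis
  proof cases
    case 1
    then have "Suc i < j \<or> Suc j < i" using ij by linarith
    then show ?thesis
      using ij krein_0[of j 1 i] \<open>1 \<le> D\<close> by (intro vanish) auto
  next
    case 2
    then show ?thesis using zero by simp
  next
    case 3
    then have "qk 1 i i *s (E i *v axis x 1) = 0"
      using diag triple_product_axis[of i x] by simp
    then have "qk 1 i i = 0"
      using E_axis_nonzero[of i] ij by simp
    then show ?thesis using vanish 3 ij by blast
  next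
    case 4
    have "sgv (E D *v (As *v (E D *v w))) = E 0 *v (As *v (E 0 *v sgv w))"
      using E_sgv[of D] As_sgv by simp
    then have "sgv (sgv (E D *v (As *v (E D *v w)))) = 0"
      using zero by (simp add: sgv_0)
    then show ?thesis using 4 by (simp add: sgv_sgv)
  qed
qed

end

section \<open>The third generator\<close>

locale third_generator = terwilliger_algebra adj D E q qk x
  for adj :: "'v::finite \<Rightarrow> 'v \<Rightarrow> bool" and D :: nat and E q qk x +
  fixes a b :: complex and cf :: "'v cvec set set \<Rightarrow> complex" and C :: "'v cmat"
  assumes a2: "a\<^sup>2 = - 1" and b2: "b\<^sup>2 = - 1"
    and cf: "\<And>\<psi>. \<psi> \<in> mod_types T \<Longrightarrow>
      (cf \<psi>)\<^sup>2 - kappaW a b q D (smat (inverse (a * vpar q D)) A) E Es (rep \<psi>) * cf \<psi> + 1 = 0"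
begin

definition "ka = inverse (a * v)"
definition "kb = inverse (b * v)"
definition "k = inverse (q\<^sup>2 - q powi (- 2))"
abbreviation "bA \<equiv> smat ka A"
abbreviation "bB \<equiv> smat kb As"

text \<open>The scalars by which the four central operators plus their inverses act on a component;
  \<open>xi\<close>, \<open>eta\<close>, \<open>zeta\<close> below belong to the three right-hand
  sides.\<close>

definition "al \<psi> = aW a q D E Es (rep \<psi>) + inverse (aW a q D E Es (rep \<psi>))"
definition "be \<psi> = bW b q D Es (rep \<psi>) + inverse (bW b q D Es (rep \<psi>))"
definition "ga \<psi> = cf \<psi> + inverse (cf \<psi>)"
definition "la \<psi> = q ^ (mod_diam Es (rep \<psi>) + 1) + inverse (q ^ (mod_diam Es (rep \<psi>) + 1))"

abbreviation "alM \<equiv> opsum T (\<lambda>\<psi>. aW a q D E Es (rep \<psi>)) + opsum T (\<lambda>\<psi>. inverse (aW a q D E Es (rep \<psi>)))"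
abbreviation "beM \<equiv> opsum T (\<lambda>\<psi>. bW b q D Es (rep \<psi>)) + opsum T (\<lambda>\<psi>. inverse (bW b q D Es (rep \<psi>)))"
abbreviation "gaM \<equiv> opsum T cf + opsum T (\<lambda>\<psi>. inverse (cf \<psi>))"
abbreviation "laM \<equiv> opsum T (\<lambda>\<psi>. q ^ (mod_diam Es (rep \<psi>) + 1))
  + opsum T (\<lambda>\<psi>. inverse (q ^ (mod_diam Es (rep \<psi>) + 1)))"

definition "xiM = smat (inverse (q + inverse q)) (alM ** laM + beM ** gaM)"
definition "etaM = smat (inverse (q + inverse q)) (beM ** laM + gaM ** alM)"
definition "zetaM = smat (inverse (q + inverse q)) (gaM ** laM + alM ** beM)"

definition "xi \<psi> = inverse (q + inverse q) * (al \<psi> * la \<psi> + be \<psi> * ga \<psi>)"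
definition "eta \<psi> = inverse (q + inverse q) * (be \<psi> * la \<psi> + ga \<psi> * al \<psi>)"
definition "zeta \<psi> = inverse (q + inverse q) * (ga \<psi> * la \<psi> + al \<psi> * be \<psi>)"

lemma opsum_products:
  assumes "\<psi> \<in> mod_types T" "w \<in> Vtype \<psi>"
  shows "xiM *v w = xi \<psi> *s w" "etaM *v w = eta \<psi> *s w" "zetaM *v w = zeta \<psi> *s w"
proof -
  have *: "alM *v w = al \<psi> *s w" "beM *v w = be \<psi> *s w" "gaM *v w = ga \<psi> *s w"
    "laM *v w = la \<psi> *s w"
    by (simp_all add: matrix_vector_mult_add_rdistrib opsum_mv[OF assms] al_def be_def ga_def la_def
        vec.scale_left_distrib)
  show "xiM *v w = xi \<psi> *s w" "etaM *v w = eta \<psi> *s w" "zetaM *v w = zeta \<psi> *s w"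
    by (simp_all only: smat_mv matrix_vector_mult_add_rdistrib[of "_ ** _"] mv_assoc * mv_scale
        xi_def eta_def zeta_def xiM_def etaM_def zetaM_def)
      (simp_all add: vec_eq_iff algebra_simps)
qed

section \<open>Consequences of the three relations\<close>

context
  assumes C1: "bA + smat k (smat q (bB ** C) - smat (inverse q) (C ** bB)) = xiM"
    and C2: "bB + smat k (smat q (C ** bA) - smat (inverse q) (bA ** C)) = etaM"
    and C3: "C + smat k (smat q (bA ** bB) - smat (inverse q) (bB ** bA)) = zetaM"
begin

lemma q_inverse: "q * (inverse q * z) = z"
  using q_0 by simp

lemma k_eq: "k = inverse (q\<^sup>2 - inverse (q\<^sup>2))"
  by (simp only: k_def powi_minus_2)

lemma a_b_nonzero: "a \<noteq> 0" "b \<noteq> 0"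
  using a2 b2 by auto

lemma constants_nonzero: "k \<noteq> 0" "ka \<noteq> 0" "kb \<noteq> 0"
  using q_diff_nonzero v_nonzero a_b_nonzero by (simp_all add: k_eq ka_def kb_def)

text \<open>With this normalisation the constant of the cubic relations cancels the leading term
  \<open>bA\<close> or \<open>bB\<close>; the sign comes from
  \<open>a\<^sup>2 = b\<^sup>2 = - 1\<close>.\<close>

lemma k_Q: "k\<^sup>2 * kb\<^sup>2 * Q = - 1" "k\<^sup>2 * ka\<^sup>2 * Q = - 1"
proof -
  have k: "k * (q\<^sup>2 - inverse (q\<^sup>2)) = 1"
    using q_diff_nonzero(1) by (simp add: k_eq)
  have "ka * v = inverse a" "kb * v = inverse b"
    using v_nonzero by (simp_all add: ka_def kb_def)
  then have ab: "(ka * v)\<^sup>2 = - 1" "(kb * v)\<^sup>2 = - 1"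
    by (simp_all add: power_inverse a2 b2)
  have "k\<^sup>2 * l\<^sup>2 * Q = (k * (q\<^sup>2 - inverse (q\<^sup>2)))\<^sup>2 * (l * v)\<^sup>2" for l
    by (simp only: Q_def power_mult_distrib mult_ac)
  then show "k\<^sup>2 * kb\<^sup>2 * Q = - 1" "k\<^sup>2 * ka\<^sup>2 * Q = - 1"
    by (simp_all only: k ab) simp_all
qed

lemma C_mv: "C *v w = zetaM *v w
   - (k * ka * kb) *s (q *s (A *v (As *v w)) - inverse q *s (As *v (A *v w)))"
proof -
  have "C *v w = zetaM *v w - smat k (smat q (bA ** bB) - smat (inverse q) (bB ** bA)) *v w"
    unfolding C3[symmetric] matrix_vector_mult_add_rdistrib by simp
  then show ?thesis
    by (simp add: smat_mv mv_assoc matrix_vector_mult_diff_rdistrib mv_scale)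
      (simp add: vec_eq_iff algebra_simps)
qed

text \<open>Substituting \<open>C_mv\<close> into the first relation assembles the cubic terms of
  \<open>relation_A\<close>, whose right side cancels \<open>ka *s (A *v w)\<close>. As
  \<open>w\<close> and \<open>As *v w\<close> lie in the component, \<open>zetaM\<close> acts on
  both by \<open>zeta \<psi>\<close>.\<close>

lemma C1_scalar:
  assumes psi: "\<psi> \<in> mod_types T" "w \<in> Vtype \<psi>" "As *v w \<in> Vtype \<psi>"
  shows "(k * kb * zeta \<psi> * (q - inverse q)) *s (As *v w) = xi \<psi> *s w"
proof -
  have "xi \<psi> *s w = ka *s (A *v w) + k *s (q *s (kb *s (As *v (C *v w)))
      - inverse q *s (C *v (kb *s (As *v w))))"
    unfolding opsum_products(1)[OF psi(1,2), symmetric] C1[symmetric]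
    by (simp add: matrix_vector_mult_add_rdistrib smat_mv mv_assoc matrix_vector_mult_diff_rdistrib)
  also have "As *v (C *v w) = zeta \<psi> *s (As *v w)
      - (k * ka * kb) *s (q *s (As *v (A *v (As *v w))) - inverse q *s (As *v (As *v (A *v w))))"
    unfolding C_mv[of w] opsum_products(3)[OF psi(1,2)]
    by (simp only: matrix_vector_mult_diff_distrib mv_scale)
  also have "C *v (kb *s (As *v w)) = kb *s (zeta \<psi> *s (As *v w)
      - (k * ka * kb) *s (q *s (A *v (As *v (As *v w))) - inverse q *s (As *v (A *v (As *v w)))))"
    unfolding mv_scale C_mv[of "As *v w"] opsum_products(3)[OF psi(1,3)] ..
  finally have "xi \<psi> *s w = ka *s (A *v w) + (k * kb * zeta \<psi> * (q - inverse q)) *s (As *v w)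
     + (k\<^sup>2 * kb\<^sup>2 * ka) *s (As *v (As *v (A *v w)) + A *v (As *v (As *v w))
     - (q\<^sup>2 + inverse (q\<^sup>2)) *s (As *v (A *v (As *v w))))"
    by (simp add: vec_eq_iff algebra_simps power2_eq_square q_inverse)
  also have "\<dots> = ka *s (A *v w) + (k * kb * zeta \<psi> * (q - inverse q)) *s (As *v w)
     + (k\<^sup>2 * kb\<^sup>2 * Q * ka) *s (A *v w)"
    unfolding relation_A by (simp add: vector_smult_assoc mult_ac)
  finally show ?thesis unfolding k_Q(1) by simp
qed

text \<open>The cubic terms stay unreduced: their reduction rests on tridiagonality, itself derived
  from this identity on the primary module.\<close>

lemma C2_scalar:
  assumes psi: "\<psi> \<in> mod_types T" "w \<in> Vtype \<psi>" "A *v w \<in> Vtype \<psi>"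
  shows "(k * ka * zeta \<psi> * (q - inverse q)) *s (A *v w) + kb *s (As *v w)
    + (k\<^sup>2 * ka\<^sup>2 * kb) *s (A *v (A *v (As *v w)) + As *v (A *v (A *v w))
     - (q\<^sup>2 + inverse (q\<^sup>2)) *s (A *v (As *v (A *v w)))) = eta \<psi> *s w"
proof -
  have "eta \<psi> *s w = kb *s (As *v w) + k *s (q *s (C *v (ka *s (A *v w)))
      - inverse q *s (ka *s (A *v (C *v w))))"
    unfolding opsum_products(2)[OF psi(1,2), symmetric] C2[symmetric]
    by (simp add: matrix_vector_mult_add_rdistrib smat_mv mv_assoc matrix_vector_mult_diff_rdistrib)
  also have "A *v (C *v w) = zeta \<psi> *s (A *v w)
      - (k * ka * kb) *s (q *s (A *v (A *v (As *v w))) - inverse q *s (A *v (As *v (A *v w))))"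
    unfolding C_mv[of w] opsum_products(3)[OF psi(1,2)]
    by (simp only: matrix_vector_mult_diff_distrib mv_scale)
  also have "C *v (ka *s (A *v w)) = ka *s (zeta \<psi> *s (A *v w)
      - (k * ka * kb) *s (q *s (A *v (As *v (A *v w))) - inverse q *s (As *v (A *v (A *v w)))))"
    unfolding mv_scale C_mv[of "A *v w"] opsum_products(3)[OF psi(1,3)] ..
  finally show ?thesis
    by (simp add: vec_eq_iff algebra_simps power2_eq_square q_inverse)
qed

lemma rep_irreducible: "\<psi> \<in> mod_types T \<Longrightarrow> irreducible_mod T (rep \<psi>)"
  using rep_mem mem_mod_types_irreducible by blast

lemma rep_Vtype: "\<psi> \<in> mod_types T \<Longrightarrow> w \<in> rep \<psi> \<Longrightarrow> w \<in> Vtype \<psi>"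
  using rep_mem Vtype_superset by blast

lemma rep_mv: "\<psi> \<in> mod_types T \<Longrightarrow> M \<in> T \<Longrightarrow> w \<in> rep \<psi> \<Longrightarrow> M *v w \<in> rep \<psi>"
  using rep_irreducible irreducible_mod_Tmodule Tmodule_mv by blast

lemma rep_csubspace: "\<psi> \<in> mod_types T \<Longrightarrow> csubspace (rep \<psi>)"
  using rep_irreducible irreducible_mod_Tmodule Tmodule_csubspace by blast

lemma rep_nonzero: "\<psi> \<in> mod_types T \<Longrightarrow> \<exists>w\<in>rep \<psi>. w \<noteq> 0"
  using rep_irreducible[of \<psi>] rep_csubspace[of \<psi>] csubspace_0[of "rep \<psi>"]
  by (auto simp: irreducible_mod_def)

section \<open>The module containing the base vertex\<close>

lemma ex_primary_type: "\<exists>\<psi>\<in>mod_types T. axis x 1 \<in> rep \<psi>"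
proof -
  \<comment> \<open>The projection at distance \<open>0\<close> has rank one, with image spanned by
    the base vertex, so a module on which it is nonzero contains that vertex.\<close>
  have Es0: "Es 0 *v w = w$x *s axis x 1" for w
    by (simp add: vec_eq_iff Es_nth axis_def)
  have "\<exists>W. irreducible_mod T W \<and> (\<exists>w\<in>W. Es 0 *v w \<noteq> 0)"
  proof (rule ccontr)
    assume "\<not> ?thesis"
    then have "W \<subseteq> {v. Es 0 *v v = 0 *v v}" if "irreducible_mod T W" for W
      using that by auto
    then have "Es 0 *v axis x 1 = 0 *v axis x 1"
      using irreducible_generate[OF csubspace_eq] by blast
    then show False by (simp add: Es0)
  qed
  then obtain W where W: "irreducible_mod T W" "\<exists>w\<in>W. Es 0 *v w \<noteq> 0"
    by blast
  define \<psi> where "\<psi> = iso_class T W"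
  have psi: "\<psi> \<in> mod_types T" "W \<in> \<psi>"
    using W(1) by (auto simp: \<psi>_def iso_class_mod_types iso_class_self)
  have T0: "Es 0 \<in> T" by (simp add: Es_in_T)
  have "\<exists>w\<in>rep \<psi>. Es 0 *v w \<noteq> 0"
    using iso_mod_vanish[OF irreducible_mod_Tmodule[OF W(1)] mem_mod_types_iso[OF psi rep_mem[OF psi(1)]] T0]
      W(2) by blast
  then obtain w where w: "w \<in> rep \<psi>" "w$x *s axis x 1 \<noteq> (0 :: 'v cvec)"
    by (auto simp: Es0)
  have "w$x *s axis x 1 \<in> rep \<psi>"
    using rep_mv[OF psi(1) T0 w(1)] by (simp add: Es0)
  then have "inverse (w$x) *s (w$x *s axis x 1) \<in> rep \<psi>"
    by (rule csubspace_scale[OF rep_csubspace[OF psi(1)]])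
  moreover have "w$x \<noteq> 0" using w(2) by auto
  ultimately show ?thesis using psi(1) by auto
qed

text \<open>Endpoint and dual endpoint are \<open>0\<close> and the diameter is \<open>D\<close>, so
  the parameters reduce to \<open>a\<close> and \<open>b\<close>, which cancel against their
  inverses.\<close>

lemma primary_parameters:
  assumes psi: "\<psi> \<in> mod_types T" and x: "axis x 1 \<in> rep \<psi>"
  shows "al \<psi> = 0" "be \<psi> = 0"
proof -
  have "Es 0 *v axis x 1 \<noteq> (0 :: 'v cvec)"
    by (auto simp: vec_eq_iff Es_nth axis_def)
  then have ep: "endpoint Es (rep \<psi>) = 0"
    unfolding endpoint_def using x by (intro Least_eq_0) blast
  have dep: "dual_endpoint E (rep \<psi>) = 0"
    unfolding dual_endpoint_def using x E_axis_nonzero[of 0] by (intro Least_eq_0) blast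
  have shift: "shift_prod cs (axis x 1) \<in> rep \<psi>" for cs
    using x rep_csubspace[OF psi] rep_mv[OF psi Talg.gA]
    by (induction cs) (auto intro: csubspace_diff csubspace_scale)
  have "\<exists>w\<in>rep \<psi>. Es i *v w \<noteq> 0" if i: "i \<le> D" for i
  proof -
    obtain y where y: "dist\<^sub>G x y = i" using ex_gdist_eq i D_diam by blast
    \<comment> \<open>With all shifts zero, \<open>?w\<close> is the \<open>i\<close>-th power of
      \<open>A\<close> on the base vertex; its entry at distance \<open>i\<close> is
      positive.\<close>
    let ?w = "shift_prod (replicate i 0) (axis x 1)"
    have "?w$y \<noteq> 0"
      using shift_prod_axis[where x = x and y = y and cs = "replicate i 0"] y by auto
    then have "(Es i *v ?w)$y \<noteq> 0" by (simp add: Es_nth y)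
    then show ?thesis using shift by (metis zero_index)
  qed
  moreover have "Es i *v w = 0" if "\<not> i \<le> D" for i w
    using that dist_le_D[of x] by (auto simp: vec_eq_iff Es_nth)
  ultimately have "{i. \<exists>w\<in>rep \<psi>. Es i *v w \<noteq> 0} = {..D}" by auto
  then have "mod_diam Es (rep \<psi>) = D" by (simp add: mod_diam_def)
  then have "aW a q D E Es (rep \<psi>) = a" "bW b q D Es (rep \<psi>) = b"
    by (simp_all add: aW_def bW_def ep dep)
  then show "al \<psi> = 0" "be \<psi> = 0"
    using a2 b2 a_b_nonzero unfolding al_def be_def
    by (simp_all add: field_simps power2_eq_square)
qed

lemma primary_triple_product:
  assumes i: "0 < i" "i < D"
  shows "E i *v (As *v (E i *v axis x 1)) = 0"
proof -
  obtain \<psi> where psi: "\<psi> \<in> mod_types T" "axis x 1 \<in> rep \<psi>"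
    using ex_primary_type by blast
  note al_be = primary_parameters[OF psi]
  have xi_eta: "xi \<psi> = 0" "eta \<psi> = 0" by (simp_all add: xi_def eta_def al_be)
  \<comment> \<open>On the base vertex \<open>As\<close> acts by \<open>th 0\<close>, nonzero as
    \<open>D\<close> is positive; with \<open>xi \<psi> = 0\<close> this forces
    \<open>zeta \<psi> = 0\<close>.\<close>
  have "As *v axis x 1 = th 0 *s (axis x 1 :: 'v cvec)"
    by (simp add: vec_eq_iff As_nth axis_def)
  then have "(k * kb * zeta \<psi> * (q - inverse q) * th 0) *s (axis x 1 :: 'v cvec) = 0"
    using C1_scalar[OF psi(1) rep_Vtype[OF psi] rep_Vtype[OF psi(1) rep_mv[OF psi(1) Talg.gAs psi(2)]]]
    by (simp add: xi_eta)
  moreover have "th 0 \<noteq> 0" using th_eq_0[of 0] D3 by auto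
  moreover have "axis x 1 \<noteq> (0 :: 'v cvec)"  by (simp add: axis_eq_0_iff)
  ultimately have zeta: "zeta \<psi> = 0"
    using constants_nonzero q_diff_nonzero by auto
  let ?w = "E i *v axis x 1"
  have w: "?w \<in> rep \<psi>"
    using rep_mv[OF psi(1) E_in_T psi(2)] i by simp
  have "kb *s (As *v ?w) + (k\<^sup>2 * ka\<^sup>2 * kb) *s (A *v (A *v (As *v ?w)) + As *v (A *v (A *v ?w))
     - (q\<^sup>2 + inverse (q\<^sup>2)) *s (A *v (As *v (A *v ?w)))) = 0"
    using C2_scalar[OF psi(1) rep_Vtype[OF psi(1) w] rep_Vtype[OF psi(1) rep_mv[OF psi(1) Talg.gA w]]]
    by (simp add: xi_eta zeta)
  \<comment> \<open>Between two copies of \<open>E i\<close> the cubic expression multiplies by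
    \<open>aw i i\<close>, which differs from \<open>Q\<close> at interior indices.\<close>
  then have "E i *v (kb *s (As *v ?w) + (k\<^sup>2 * ka\<^sup>2 * kb) *s (A *v (A *v (As *v ?w)) + As *v (A *v (A *v ?w))
     - (q\<^sup>2 + inverse (q\<^sup>2)) *s (A *v (As *v (A *v ?w))))) = 0"
    by simp
  also have "E i *v (kb *s (As *v ?w) + (k\<^sup>2 * ka\<^sup>2 * kb) *s (A *v (A *v (As *v ?w)) + As *v (A *v (A *v ?w))
     - (q\<^sup>2 + inverse (q\<^sup>2)) *s (A *v (As *v (A *v ?w)))))
     = (kb * (1 + k\<^sup>2 * ka\<^sup>2 * aw i i)) *s (E i *v (As *v ?w))"
    unfolding matrix_vector_mult_diff_distrib matrix_vector_right_distrib mv_scale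
    using i by (simp add: E_A_mv A_E_mv mv_scale matrix_vector_mult_diff_distrib matrix_vector_right_distrib)
        (simp add: vec_eq_iff aw_def algebra_simps power2_eq_square)
  finally have "(kb * (1 + k\<^sup>2 * ka\<^sup>2 * aw i i)) *s (E i *v (As *v ?w)) = 0" .
  moreover have "1 + k\<^sup>2 * ka\<^sup>2 * aw i i \<noteq> 0"
  proof
    assume "1 + k\<^sup>2 * ka\<^sup>2 * aw i i = 0"
    then have "k\<^sup>2 * ka\<^sup>2 * aw i i = k\<^sup>2 * ka\<^sup>2 * Q"
      using k_Q(2) by (simp add: add_eq_0_iff)
    then have "aw i i = Q"
      using constants_nonzero by (metis mult_left_cancel power_not_zero no_zero_divisors)
    then show False using aw_diag_neq i by blast
  qed
  ultimately show ?thesis using constants_nonzero by auto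
qed

lemma tridiagonal:
  "i \<le> D \<Longrightarrow> j \<le> D \<Longrightarrow> j \<noteq> Suc i \<Longrightarrow> i \<noteq> Suc j \<Longrightarrow> E i *v (As *v (E j *v w)) = 0"
  by (rule triple_product_tridiagonal[OF primary_triple_product])

text \<open>Now \<open>relation_As\<close> reduces the cubic terms of \<open>C2_scalar\<close> to a
  multiple of \<open>As *v w\<close> that cancels \<open>kb *s (As *v w)\<close>.\<close>

lemma C2_scalar':
  assumes psi: "\<psi> \<in> mod_types T" "w \<in> Vtype \<psi>" "A *v w \<in> Vtype \<psi>"
  shows "(k * ka * zeta \<psi> * (q - inverse q)) *s (A *v w) = eta \<psi> *s w"
proof -
  have rel: "A *v (A *v (As *v w)) + As *v (A *v (A *v w))
     - (q\<^sup>2 + inverse (q\<^sup>2)) *s (A *v (As *v (A *v w))) = Q *s (As *v w)"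
    by (rule relation_As) (rule tridiagonal)
  have "(k * ka * zeta \<psi> * (q - inverse q)) *s (A *v w) + kb *s (As *v w)
    + (k\<^sup>2 * ka\<^sup>2 * kb) *s (Q *s (As *v w)) = eta \<psi> *s w"
    using C2_scalar[OF psi] unfolding rel .
  moreover have "k\<^sup>2 * ka\<^sup>2 * kb * Q = - kb"
  proof -
    have "k\<^sup>2 * ka\<^sup>2 * kb * Q = (k\<^sup>2 * ka\<^sup>2 * Q) * kb" by (simp only: mult_ac)
    then show ?thesis by (simp only: k_Q(2)) simp
  qed
  ultimately show ?thesis by (simp add: vector_smult_assoc)
qed

text \<open>A module on which both generators act as scalars lies in the middle subconstituent
  and in the middle eigenspace, so \<open>d = 0\<close> and \<open>\<kappa> = 0\<close> by convention.\<close>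

lemma scalar_module_parameters:
  assumes psi: "\<psi> \<in> mod_types T"
    and As: "\<And>w. w \<in> rep \<psi> \<Longrightarrow> As *v w = s *s w" and A: "\<And>w. w \<in> rep \<psi> \<Longrightarrow> A *v w = t *s w"
  shows "al \<psi> = 0" "be \<psi> = 0" "ga \<psi> = 0"
proof -
  let ?W = "rep \<psi>"
  obtain w0 where w0: "w0 \<in> ?W" "w0 \<noteq> 0" using rep_nonzero[OF psi] by blast
  then obtain y0 where y0: "w0$y0 \<noteq> 0" by (auto simp: vec_eq_iff)
  have supp: "th (dist\<^sub>G x y) = s" if "w \<in> ?W" "w$y \<noteq> 0" for w y
    using As[OF that(1)] that(2) As_nth[of w y] by simp
  \<comment> \<open>As \<open>As\<close> is scalar and \<open>th\<close> injective, the support of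
    \<open>w0\<close> lies at one distance from \<open>x\<close> and so contains no edge; hence
    \<open>A *v w0\<close> vanishes at \<open>y0\<close>.\<close>
  have "w0$z = 0" if "adj y0 z" for z
  proof (rule ccontr)
    assume "w0$z \<noteq> 0"
    then have "th (dist\<^sub>G x z) = th (dist\<^sub>G x y0)" using supp w0 y0 by simp
    then have "dist\<^sub>G x z = dist\<^sub>G x y0" by (intro th_inj dist_le_D)
    then show False using gdist_adj[OF that, of x] by simp
  qed
  then have "(A *v w0)$y0 = 0" by (simp add: A_mv_nth)
  then have t: "t = 0" using A[OF w0(1)] y0 by simp
  obtain i where i: "i \<le> D" "E i *v w0 \<noteq> 0"
    using sum_E_mv[of w0] w0(2) by (metis atMost_iff sum.neutral)
  have "th i *s (E i *v w0) = 0"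
    using E_A_mv[OF i(1), of w0] A[OF w0(1)] by (simp add: t)
  then have th_i: "th i = 0" using i by simp
  then have Di: "D = 2 * i" using th_eq_0 i by blast
  have Ej: "E j *v w = (if j = i then w else 0)" if "w \<in> ?W" "j \<le> D" for j w
    using eigenvector_E[of w i j] A[OF that(1)] i that(2) by (simp add: t th_i)
  \<comment> \<open>\<open>w0\<close> lies in the eigenspace of index \<open>i\<close>, where the
    diagonal block of \<open>As\<close> vanishes, so \<open>s = 0\<close>.\<close>
  have "E i *v (As *v (E i *v w0)) = 0"
    by (rule tridiagonal) (use i in auto)
  then have "s *s w0 = 0"
    using Ej[OF w0(1) i(1)] As[OF w0(1)] by (simp add: mv_scale)
  then have s: "s = 0" using w0 by simp
  have dist_i: "dist\<^sub>G x y = i" if "w \<in> ?W" "w$y \<noteq> 0" for w y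
    using th_eq_0[OF dist_le_D] supp[OF that] s Di by fastforce
  have Es_iff: "(\<exists>w\<in>?W. Es j *v w \<noteq> 0) \<longleftrightarrow> j = i" for j
  proof
    assume "\<exists>w\<in>?W. Es j *v w \<noteq> 0"
    then show "j = i" using dist_i by (auto simp: vec_eq_iff Es_nth split: if_splits)
  next
    assume "j = i"
    then have "(Es j *v w0)$y0 \<noteq> 0" using dist_i[OF w0(1) y0] y0 by (simp add: Es_nth)
    then show "\<exists>w\<in>?W. Es j *v w \<noteq> 0" using w0(1) by (metis zero_index)
  qed
  have ep: "endpoint Es ?W = i" and d: "mod_diam Es ?W = 0"
    unfolding endpoint_def mod_diam_def Es_iff by (auto intro: Least_equality)
  have dep: "dual_endpoint E ?W = i"
    unfolding dual_endpoint_def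
  proof (rule Least_equality)
    show "\<exists>w\<in>?W. E i *v w \<noteq> 0" using w0(1) i by blast
    show "i \<le> j" if "\<exists>w\<in>?W. E j *v w \<noteq> 0" for j
      using that Ej i by (metis le_trans nat_le_linear)
  qed
  have "aW a q D E Es ?W = a" "bW b q D Es ?W = b"
    by (simp_all add: aW_def bW_def ep dep d Di)
  then show "al \<psi> = 0" "be \<psi> = 0"
    using a2 b2 a_b_nonzero unfolding al_def be_def
    by (simp_all add: field_simps power2_eq_square)
  have "(cf \<psi>)\<^sup>2 + 1 = 0"
    using cf[OF psi] by (simp add: kappaW_def d)
  then show "ga \<psi> = 0"
    unfolding ga_def by (cases "cf \<psi> = 0") (simp_all add: field_simps power2_eq_square)
qed

section \<open>Vanishing of the three scalars\<close>

text \<open>Dividing by a nonzero \<open>zeta \<psi>\<close> in \<open>C1_scalar\<close> and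
  \<open>C2_scalar'\<close> would make both generators scalar on the module, and then
  \<open>zeta \<psi> = 0\<close> by \<open>scalar_module_parameters\<close>.\<close>

lemma zeta_0:
  assumes psi: "\<psi> \<in> mod_types T" shows "zeta \<psi> = 0"
proof (rule ccontr)
  assume "zeta \<psi> \<noteq> 0"
  then have nz: "k * kb * zeta \<psi> * (q - inverse q) \<noteq> 0" "k * ka * zeta \<psi> * (q - inverse q) \<noteq> 0"
    using constants_nonzero q_diff_nonzero by auto
  have scalar: "u = (e / c) *s w" if "c *s u = e *s w" "c \<noteq> 0" for c e and u w :: "'v cvec"
    using that by (simp add: vec_eq_iff field_simps)
  have As_scalar: "As *v w = (xi \<psi> / (k * kb * zeta \<psi> * (q - inverse q))) *s w"
    if w: "w \<in> rep \<psi>" for w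
    using C1_scalar[OF psi rep_Vtype[OF psi w] rep_Vtype[OF psi rep_mv[OF psi Talg.gAs w]]] nz(1)
    by (rule scalar)
  have A_scalar: "A *v w = (eta \<psi> / (k * ka * zeta \<psi> * (q - inverse q))) *s w"
    if w: "w \<in> rep \<psi>" for w
    using C2_scalar'[OF psi rep_Vtype[OF psi w] rep_Vtype[OF psi rep_mv[OF psi Talg.gA w]]] nz(2)
    by (rule scalar)
  have "al \<psi> = 0" "be \<psi> = 0" "ga \<psi> = 0"
    by (rule scalar_module_parameters[OF psi As_scalar A_scalar]; assumption)+
  then have "zeta \<psi> = 0" by (simp add: zeta_def)
  with \<open>zeta \<psi> \<noteq> 0\<close> show False by simp
qed

lemma xi_eta_0:
  assumes psi: "\<psi> \<in> mod_types T" shows "xi \<psi> = 0" "eta \<psi> = 0"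
proof -
  obtain w where w: "w \<in> rep \<psi>" "w \<noteq> 0" using rep_nonzero[OF psi] by blast
  have "xi \<psi> *s w = 0"
    using C1_scalar[OF psi rep_Vtype[OF psi w(1)] rep_Vtype[OF psi rep_mv[OF psi Talg.gAs w(1)]]]
    by (simp add: zeta_0[OF psi])
  moreover have "eta \<psi> *s w = 0"
    using C2_scalar'[OF psi rep_Vtype[OF psi w(1)] rep_Vtype[OF psi rep_mv[OF psi Talg.gA w(1)]]]
    by (simp add: zeta_0[OF psi])
  ultimately show "xi \<psi> = 0" "eta \<psi> = 0" using w(2) by auto
qed

lemma right_hand_sides_0: "xiM = 0" "etaM = 0" "zetaM = 0"
  by (rule matrix_eq_on_irreducible, simp add: opsum_products xi_eta_0 zeta_0)+

end

end

theorem theorem6p9: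
  fixes adj :: "'v::finite \<Rightarrow> 'v \<Rightarrow> bool" and x :: 'v and D :: nat
    and E :: "nat \<Rightarrow> 'v cmat" and q a b :: complex
    and cf :: "'v cvec set set \<Rightarrow> complex" and C :: "'v cmat"
  defines "T \<equiv> Talg (Amat adj) (Astar E x)"
    and "Es \<equiv> Estar adj x"
    and "bA \<equiv> smat (inverse (a * vpar q D)) (Amat adj)"
    and "bB \<equiv> smat (inverse (b * vpar q D)) (Astar E x)"
    and "ba \<equiv> opsum (Talg (Amat adj) (Astar E x)) (\<lambda>\<psi>. aW a q D E (Estar adj x) (rep \<psi>))"
    and "bai \<equiv> opsum (Talg (Amat adj) (Astar E x)) (\<lambda>\<psi>. inverse (aW a q D E (Estar adj x) (rep \<psi>)))"
    and "bb \<equiv> opsum (Talg (Amat adj) (Astar E x)) (\<lambda>\<psi>. bW b q D (Estar adj x) (rep \<psi>))"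
    and "bbi \<equiv> opsum (Talg (Amat adj) (Astar E x)) (\<lambda>\<psi>. inverse (bW b q D (Estar adj x) (rep \<psi>)))"
    and "bc \<equiv> opsum (Talg (Amat adj) (Astar E x)) cf"
    and "bci \<equiv> opsum (Talg (Amat adj) (Astar E x)) (\<lambda>\<psi>. inverse (cf \<psi>))"
    and "Lam \<equiv> opsum (Talg (Amat adj) (Astar E x)) (\<lambda>\<psi>. q ^ (mod_diam (Estar adj x) (rep \<psi>) + 1))"
    and "Lami \<equiv> opsum (Talg (Amat adj) (Astar E x)) (\<lambda>\<psi>. inverse (q ^ (mod_diam (Estar adj x) (rep \<psi>) + 1)))"
  assumes graph: "simple_graph adj" "connected_graph adj" "distance_regular adj"
      "bipartite adj" "two_homogeneous adj" "\<not> is_hypercube adj"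
    and D: "D = diam adj" "D \<ge> 3"
    and E_prim: "inj_on E {..D}" "E ` {..D} = {P. prim_idem (BM adj) P}"
    and E0: "E 0 = smat (1 / of_nat CARD('v)) Jmat"
    and Qpoly: "Q_polynomial adj E"
    and q: "q \<noteq> 0" "q ^ 4 \<noteq> 1"
    and theta: "Amat adj = (\<Sum>i\<le>D. smat (thq q D i) (E i))"
    and theta_star: "Astar E x = (\<Sum>i\<le>D. smat (thq q D i) (Es i))"
    and a: "a\<^sup>2 = (- vpar q D) / vpar q D"
    and b: "b\<^sup>2 = (- vpar q D) / vpar q D"
    and c: "\<forall>\<psi>\<in>mod_types T. (cf \<psi>)\<^sup>2 - kappaW a b q D bA E Es (rep \<psi>) * cf \<psi> + 1 = 0"
    and C_T: "C \<in> T"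
    and C1: "bA + smat (inverse (q\<^sup>2 - q powi (-2))) (smat q (bB ** C) - smat (inverse q) (C ** bB))
       = smat (inverse (q + inverse q)) ((ba + bai) ** (Lam + Lami) + (bb + bbi) ** (bc + bci))"
    and C2: "bB + smat (inverse (q\<^sup>2 - q powi (-2))) (smat q (C ** bA) - smat (inverse q) (bA ** C))
       = smat (inverse (q + inverse q)) ((bb + bbi) ** (Lam + Lami) + (bc + bci) ** (ba + bai))"
    and C3: "C + smat (inverse (q\<^sup>2 - q powi (-2))) (smat q (bA ** bB) - smat (inverse q) (bB ** bA))
       = smat (inverse (q + inverse q)) ((bc + bci) ** (Lam + Lami) + (ba + bai) ** (bb + bbi))"
  shows "bA + smat (inverse (q\<^sup>2 - q powi (-2))) (smat q (bB ** C) - smat (inverse q) (C ** bB)) = 0 \<and>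
     bB + smat (inverse (q\<^sup>2 - q powi (-2))) (smat q (C ** bA) - smat (inverse q) (bA ** C)) = 0 \<and>
     C + smat (inverse (q\<^sup>2 - q powi (-2))) (smat q (bA ** bB) - smat (inverse q) (bB ** bA)) = 0"
proof -
  obtain qk :: "nat \<Rightarrow> nat \<Rightarrow> nat \<Rightarrow> complex" where qk:
    "\<forall>i\<le>diam adj. \<forall>j\<le>diam adj. hadamard (E i) (E j) =
         smat (1 / of_nat CARD('v)) (\<Sum>h\<le>diam adj. smat (qk i j h) (E h))"
    "\<forall>h i j. h \<le> diam adj \<and> i \<le> diam adj \<and> j \<le> diam adj \<longrightarrow>
        ((h > i + j \<or> i > h + j \<or> j > h + i) \<longrightarrow> qk i j h = 0)"
    using Qpoly unfolding Q_polynomial_def by blast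
  interpret terwilliger_algebra adj D E q qk x
  proof unfold_locales
    show "hadamard (E i) (E j) = smat (1 / of_nat CARD('v)) (\<Sum>h\<le>D. smat (qk i j h) (E h))"
      if "i \<le> D" "j \<le> D" for i j
      using qk(1) that D(1) by simp
    show "qk i j h = 0"
      if "h \<le> D" "i \<le> D" "j \<le> D" "h > i + j \<or> i > h + j \<or> j > h + i" for h i j
      using qk(2) that D(1) by blast
  qed (use graph D E_prim q theta theta_star in \<open>simp_all add: Es_def\<close>)
  \<comment> \<open>The quotient \<open>- v / v\<close> equals \<open>-1\<close> only for nonzero
    \<open>v\<close>, a fact supplied by the interpretation just made.\<close>
  have "a\<^sup>2 = - 1" "b\<^sup>2 = - 1"
    using a b v_nonzero by simp_all
  then interpret third_generator adj D E q qk x a b cf C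
    by unfold_locales (use c in \<open>simp_all add: T_def Es_def bA_def\<close>)
  note defs = T_def Es_def bA_def bB_def ba_def bai_def bb_def bbi_def bc_def bci_def
    Lam_def Lami_def
  note gen_defs = ka_def kb_def k_def xiM_def etaM_def zetaM_def
  have rhs: "xiM = 0" "etaM = 0" "zetaM = 0"
    using right_hand_sides_0 C1 C2 C3 unfolding defs gen_defs by blast+
  show ?thesis
    unfolding C1 C2 C3 using rhs unfolding defs gen_defs by blast
qed

end
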